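(* Let $\Delta$ be a finite $(d-1)$-dimensional simplicial complex, $r\geq 1$, and let $\mathcal{C}^r(\Delta)$ be the clique complex of the graph on the set of $r$-multichains $A_1\subseteq\cdots\subseteq A_r$ of nonempty faces of $\Delta$ in which two distinct multichains $\mathfrak{p},\mathfrak{q}$ are adjacent iff $\mathfrak{p}\preceq_I\mathfrak{q}$ or $\mathfrak{q}\preceq_I\mathfrak{p}$, where $\mathfrak{p}\preceq_I\mathfrak{q}$ means $p_t\supseteq q_s$ for all $s\leq t-1$ and $p_t\subseteq q_s$ for all $s\geq t$. Then for $0\leq m\leq d$, $$h_m(\mathcal{C}^r(\Delta))=\sum_{k=0}^{d}A^{(0)}(d+1,k+1,m)\,h_k(\Delta),$$ i.e. $h(\mathcal{C}^r(\Delta))=\mathcal{R}_d\,h(\Delta)$ with transformation matrix given by the numbers $A^{(0)}(d+1,k+1,m)$, $0\le k,m\le d$.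
   Context: The $h$-vector $(h_0,\dots,h_d)$ of a $(d-1)$-dimensional complex $\Gamma$ is defined by $\sum_i h_i t^i=(1-t)^d\sum_{i=0}^d f_{i-1}(\Gamma)(t/(1-t))^i$, where $f_{i-1}$ counts faces with $i$ elements. $A^{(0)}(n,j,m)$ is the number of $r$-colored permutations $\sigma=(\sigma_1^{\epsilon_1},\dots,\sigma_n^{\epsilon_n})$ of $[n]$ (colors $\epsilon_i\in\{0,\dots,r-1\}$) with $\epsilon_1=0$, $\epsilon_n=0$, $\sigma_n=n+1-j$ and $\mathrm{des}(\sigma)=m$; here, with $\sigma_{n+1}:=n+1$, $\epsilon_{n+1}:=0$, $\mathrm{des}(\sigma)$ is the number of $1\le i\le n$ with $\epsilon_i>\epsilon_{i+1}$, or $\epsilon_i=\epsilon_{i+1}$ and $\sigma_i>\sigma_{i+1}$. *)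

theory Defs
  imports
    "HOL-Library.FuncSet"
    "HOL-Combinatorics.Permutations"
    "HOL-Computational_Algebra.Polynomial_FPS"
begin

text \<open>
  A complex is the set of its faces. The empty set is always a face, so the smallest complex
  is \<open>{{}}\<close>, of dimension \<open>-1\<close>.
\<close>

definition abstract_simplicial_complex :: "'a set set \<Rightarrow> bool" where
  "abstract_simplicial_complex \<Delta> \<longleftrightarrow>
     {} \<in> \<Delta> \<and> (\<forall>F\<in>\<Delta>. finite F) \<and> (\<forall>F\<in>\<Delta>. \<forall>G. G \<subseteq> F \<longrightarrow> G \<in> \<Delta>)"

definition complex_dim :: "'a set set \<Rightarrow> int" where
  "complex_dim \<Delta> = int (Max (card ` \<Delta>)) - 1"

text \<open>\<open>face_count \<Gamma> i\<close> is the entry \<open>f\<^bsub>i-1\<^esub>\<close> of the f-vector.\<close>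

definition face_count :: "'a set set \<Rightarrow> nat \<Rightarrow> nat" where
  "face_count \<Gamma> i = card {F \<in> \<Gamma>. card F = i}"

definition h_series :: "'a set set \<Rightarrow> rat fps" where
  "h_series \<Gamma> =
     (let d = nat (complex_dim \<Gamma> + 1) in
       (1 - fps_X) ^ d * (\<Sum>i=0..d. of_nat (face_count \<Gamma> i) * (fps_X / (1 - fps_X)) ^ i))"

definition h_vector :: "'a set set \<Rightarrow> nat \<Rightarrow> rat" where
  "h_vector \<Gamma> i = fps_nth (h_series \<Gamma>) i"

text \<open>The series is in fact a polynomial of degree at most \<open>d\<close>.\<close>

lemma h_series_eq_sum:
  assumes "complex_dim \<Gamma> = int d - 1"
  shows "(\<Sum>i=0..d. fps_const (h_vector \<Gamma> i) * fps_X ^ i) = h_series \<Gamma>"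
proof -
  have unit: "(1 - fps_X :: rat fps) * (fps_X / (1 - fps_X)) = fps_X"
    by (simp add: fps_divide_unit mult.left_commute inverse_mult_eq_1')
  define p :: "rat poly" where
    "p = (\<Sum>i=0..d. of_nat (face_count \<Gamma> i) * ([:0, 1:] ^ i * [:1, -1:] ^ (d - i)))"
  have lin: "fps_of_poly [:1, -1::rat:] = 1 - fps_X"
    by (simp add: fps_of_poly_pCons)
  have x: "fps_of_poly [:0, 1::rat:] = fps_X"
    by (simp add: fps_of_poly_pCons)
  have nat: "fps_of_poly (of_nat n) = (of_nat n :: rat fps)" for n
    by (induction n) (simp_all add: fps_of_poly_add)
  have "h_series \<Gamma> = (\<Sum>i=0..d. of_nat (face_count \<Gamma> i) * (fps_X ^ i * (1 - fps_X) ^ (d - i)))"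
  proof -
    have dim: "nat (complex_dim \<Gamma> + 1) = d"
      using assms by simp
    show ?thesis
      unfolding h_series_def Let_def sum_distrib_left dim
      proof (intro sum.cong refl)
        fix i assume "i \<in> {0..d}"
        then have "(1 - fps_X :: rat fps) ^ d = (1 - fps_X) ^ (d - i) * (1 - fps_X) ^ i"
          by (simp flip: power_add)
        then have pow: "(1 - fps_X :: rat fps) ^ d * (fps_X / (1 - fps_X)) ^ i
            = fps_X ^ i * (1 - fps_X) ^ (d - i)"
          by (simp only: mult.assoc power_mult_distrib[symmetric] unit mult.commute[of "fps_X ^ i"])
        show "(1 - fps_X) ^ d * (of_nat (face_count \<Gamma> i) * (fps_X / (1 - fps_X)) ^ i)
            = (of_nat (face_count \<Gamma> i) * (fps_X ^ i * (1 - fps_X) ^ (d - i)) :: rat fps)"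
          by (subst mult.left_commute) (simp only: pow)
      qed
  qed
  also have "\<dots> = fps_of_poly p"
    by (simp add: p_def fps_of_poly_sum fps_of_poly_mult fps_of_poly_power lin x nat)
  finally have eq: "h_series \<Gamma> = fps_of_poly p" .
  have "degree p \<le> d"
    unfolding p_def
  proof (rule degree_sum_le)
    fix i assume i: "i \<in> {0..d}"
    have "degree ([:0, 1::rat:] ^ i * [:1, -1:] ^ (d - i)) \<le> i + (d - i)"
      by (intro order.trans[OF degree_mult_le] add_mono order.trans[OF degree_power_le]) auto
    then show "degree (of_nat (face_count \<Gamma> i) * ([:0, 1::rat:] ^ i * [:1, -1:] ^ (d - i))) \<le> d"
      using i by (intro order.trans[OF degree_mult_le]) (simp del: mult_pCons_left mult_pCons_right)
  qed simp
  then have "fps_nth (h_series \<Gamma>) n = 0" if "n > d" for n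
    using that by (simp add: eq coeff_eq_0)
  then show ?thesis
    by (auto simp: fps_eq_iff fps_sum_nth h_vector_def if_distrib cong: if_cong)
qed

definition clique_complex :: "'v set \<Rightarrow> ('v \<Rightarrow> 'v \<Rightarrow> bool) \<Rightarrow> 'v set set" where
  "clique_complex V adj =
     {K. finite K \<and> K \<subseteq> V \<and> (\<forall>p\<in>K. \<forall>q\<in>K. p \<noteq> q \<longrightarrow> adj p q)}"

text \<open>
  An \<open>r\<close>-multichain \<open>A\<^sub>1 \<subseteq> \<dots> \<subseteq> A\<^sub>r\<close> is the list \<open>[A\<^sub>1, \<dots>, A\<^sub>r]\<close>; list positions start at 0,
  so \<open>s \<le> t - 1\<close> reads \<open>s < t\<close>.
\<close>

definition multichains :: "nat \<Rightarrow> 'a set set \<Rightarrow> 'a set list set" where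
  "multichains r \<Delta> = {p. length p = r \<and> set p \<subseteq> \<Delta> - {{}} \<and> sorted_wrt (\<subseteq>) p}"

definition interlace_le :: "nat \<Rightarrow> 'a set list \<Rightarrow> 'a set list \<Rightarrow> bool" where
  "interlace_le r p q \<longleftrightarrow>
     (\<forall>t<r. (\<forall>s<r. s < t \<longrightarrow> p ! t \<supseteq> q ! s) \<and> (\<forall>s<r. s \<ge> t \<longrightarrow> p ! t \<subseteq> q ! s))"

definition multichain_complex :: "nat \<Rightarrow> 'a set set \<Rightarrow> 'a set list set set" where
  "multichain_complex r \<Delta> =
     clique_complex (multichains r \<Delta>)
       (\<lambda>p q. p \<noteq> q \<and> (interlace_le r p q \<or> interlace_le r q p))"

definition colored_perms :: "nat \<Rightarrow> nat \<Rightarrow> ((nat \<Rightarrow> nat) \<times> (nat \<Rightarrow> nat)) set" where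
  "colored_perms r n = {(\<sigma>, \<epsilon>). \<sigma> permutes {1..n} \<and> \<epsilon> \<in> {1..n} \<rightarrow>\<^sub>E {0..<r}}"

definition des :: "nat \<Rightarrow> (nat \<Rightarrow> nat) \<Rightarrow> (nat \<Rightarrow> nat) \<Rightarrow> nat" where
  "des n \<sigma> \<epsilon> =
     (let \<sigma>' = \<sigma>(n + 1 := n + 1); \<epsilon>' = \<epsilon>(n + 1 := 0) in
       card {i \<in> {1..n}. \<epsilon>' i > \<epsilon>' (i + 1) \<or> (\<epsilon>' i = \<epsilon>' (i + 1) \<and> \<sigma>' i > \<sigma>' (i + 1))})"

definition A0 :: "nat \<Rightarrow> nat \<Rightarrow> nat \<Rightarrow> nat \<Rightarrow> nat" where
  "A0 r n j m =
     card {(\<sigma>, \<epsilon>) \<in> colored_perms r n.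
             \<epsilon> 1 = 0 \<and> \<epsilon> n = 0 \<and> \<sigma> n = n + 1 - j \<and> des n \<sigma> \<epsilon> = m}"

end

theory Submission
  imports Defs
begin

text \<open>
  Interlacing a clique of \<open>j\<close> multichains, repetitions allowed, gives a single multichain of length
  \<open>r j\<close>. Hence the Hilbert series of the Stanley-Reisner ring of \<open>\<C>\<^sup>r(\<Delta>)\<close>, which is
  \<open>h(\<C>\<^sup>r(\<Delta>), t) / (1 - t)\<^sup>d\<close>, equals \<open>\<Sum>\<^sub>j Z(r j) t\<^sup>j\<close>, where \<open>Z(N)\<close> is the number of \<open>N\<close>-multichains
  of nonempty faces of \<open>\<Delta>\<close>. Allowing empty faces there are \<open>Y(N) = \<Sum>\<^sub>F N\<^bsup>|F|\<^esup>\<close> multichains, so that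
  \<open>Z(N) = Y(N) - Y(N - 1)\<close>, and \<open>Y(N) = \<Sum>\<^sub>k h\<^sub>k(\<Delta>) N\<^sup>k (N + 1)\<^bsup>d-k\<^esup>\<close> by the definition of the h-vector.
  The coefficient \<open>N\<^sup>k (N + 1)\<^bsup>d-k\<^esup> - (N - 1)\<^sup>k N\<^bsup>d-k\<^esup>\<close> of \<open>h\<^sub>k(\<Delta>)\<close> in \<open>Z(N)\<close> counts the sequences
  \<open>g : [d + 1] \<rightarrow> {0..N}\<close> that attain 0 and attain the value \<open>N\<close> last at the position \<open>d + 1 - k\<close>.
  For \<open>N = r j\<close>, sorting such a sequence yields a colored permutation whose colors are the remainders
  of the values modulo \<open>r\<close>, while the quotients form a sequence from 0 to \<open>j\<close> that rises at every
  descent; summing over \<open>j\<close>, each colored permutation contributes \<open>t\<^bsup>des\<^esup> / (1 - t)\<^sup>d\<close>.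
\<close>

section \<open>Counting multichains by the h-vector\<close>

lemma sum_power_card_Pow:
  fixes x :: "'b::comm_semiring_1"
  assumes "finite F"
  shows "(\<Sum>G\<in>Pow F. x ^ card G) = (x + 1) ^ card F"
  using prod_add[OF assms, of "\<lambda>_. x" "\<lambda>_. 1"] by simp

text \<open>Unlike \<open>multichains\<close>, this allows the empty face. The part of such a list
  below its last face F is then a weak chain of \<open>Pow F\<close>, again a complex, which makes
  induction on the length possible.\<close>

definition weak_chains :: "nat \<Rightarrow> 'a set set \<Rightarrow> 'a set list set" where
  "weak_chains N \<Delta> = {p. length p = N \<and> set p \<subseteq> \<Delta> \<and> sorted_wrt (\<subseteq>) p}"

lemma finite_weak_chains:
  assumes "finite \<Delta>"
  shows "finite (weak_chains N \<Delta>)"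
  by (rule finite_subset[OF _ finite_lists_length_eq[OF assms, of N]]) (auto simp: weak_chains_def)

lemma abstract_simplicial_complex_Pow:
  "finite F \<Longrightarrow> abstract_simplicial_complex (Pow F)"
  by (auto simp: abstract_simplicial_complex_def intro: finite_subset)

text \<open>Split off the last and largest face F. The remaining list is a weak chain of length N in
  \<open>Pow F\<close>, and summing N ^ card G over the subsets G of F gives (N + 1) ^ card F by the
  binomial theorem. The induction therefore has to range over all complexes.\<close>

lemma card_weak_chains:
  fixes \<Delta> :: "'a set set"
  assumes "finite \<Delta>" "abstract_simplicial_complex \<Delta>"
  shows "card (weak_chains N \<Delta>) = (\<Sum>F\<in>\<Delta>. N ^ card F)"
  using assms
proof (induction N arbitrary: \<Delta>)
  case 0
  have "weak_chains 0 \<Delta> = {[]}"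
    by (auto simp: weak_chains_def)
  \<comment> \<open>Since 0 ^ 0 = 1, only the empty face contributes for N = 0.\<close>
  moreover have "(\<Sum>F\<in>\<Delta>. 0 ^ card F) = (\<Sum>F\<in>{{} :: 'a set}. 0 ^ card F :: nat)"
    using 0 by (intro sum.mono_neutral_right) (auto simp: abstract_simplicial_complex_def)
  ultimately show ?case
    by simp
next
  case (Suc N)
  have fin: "finite F" if "F \<in> \<Delta>" for F
    using that Suc.prems by (auto simp: abstract_simplicial_complex_def)
  have "weak_chains (Suc N) \<Delta> = (\<lambda>(F, p). p @ [F]) ` Sigma \<Delta> (\<lambda>F. weak_chains N (Pow F))"
    (is "_ = ?f ` ?S")
  proof (intro equalityI subsetI)
    fix p assume p: "p \<in> weak_chains (Suc N) \<Delta>"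
    then have "p \<noteq> []"
      by (auto simp: weak_chains_def)
    then obtain q F where "p = q @ [F]"
      by (metis rev_exhaust)
    with p show "p \<in> ?f ` ?S"
      by (intro image_eqI[of _ _ "(F, q)"]) (auto simp: weak_chains_def sorted_wrt_append)
  next
    fix p assume "p \<in> ?f ` ?S"
    then obtain F q where "p = q @ [F]" "F \<in> \<Delta>" "length q = N" "sorted_wrt (\<subseteq>) q"
      and sub: "\<forall>G\<in>set q. G \<subseteq> F"
      by (auto simp: weak_chains_def Pow_def)
    moreover have "set q \<subseteq> \<Delta>"
      using sub \<open>F \<in> \<Delta>\<close> Suc.prems(2) by (auto simp: abstract_simplicial_complex_def)
    ultimately show "p \<in> weak_chains (Suc N) \<Delta>"
      by (simp add: weak_chains_def sorted_wrt_append)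
  qed
  moreover have "inj_on ?f ?S"
    by (auto simp: inj_on_def)
  ultimately have "card (weak_chains (Suc N) \<Delta>) = card ?S"
    by (simp add: card_image)
  also have "\<dots> = (\<Sum>F\<in>\<Delta>. card (weak_chains N (Pow F)))"
    using Suc.prems fin by (subst card_SigmaI) (auto intro: finite_weak_chains)
  also have "\<dots> = (\<Sum>F\<in>\<Delta>. \<Sum>G\<in>Pow F. N ^ card G)"
    using fin by (intro sum.cong refl Suc.IH) (auto intro: abstract_simplicial_complex_Pow)
  also have "\<dots> = (\<Sum>F\<in>\<Delta>. Suc N ^ card F)"
    using fin by (intro sum.cong refl) (simp add: sum_power_card_Pow)
  finally show ?case .
qed

lemma multichains_0: "multichains 0 \<Delta> = {[]}"
  by (auto simp: multichains_def)

text \<open>A weak chain either starts with a nonempty face, and then all its faces are nonempty, or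
  it is the empty face followed by an arbitrary weak chain of length N. The additive form avoids
  truncated subtraction.\<close>

lemma card_multichains_Suc:
  assumes "finite \<Delta>" "abstract_simplicial_complex \<Delta>"
  shows "card (multichains (Suc N) \<Delta>) + (\<Sum>F\<in>\<Delta>. N ^ card F) = (\<Sum>F\<in>\<Delta>. Suc N ^ card F)"
proof -
  have sub: "multichains (Suc N) \<Delta> \<subseteq> weak_chains (Suc N) \<Delta>"
    by (auto simp: weak_chains_def multichains_def)
  have eq: "weak_chains (Suc N) \<Delta> = multichains (Suc N) \<Delta> \<union> (#) {} ` weak_chains N \<Delta>"
  proof (intro equalityI subsetI)
    fix p assume p: "p \<in> weak_chains (Suc N) \<Delta>"
    then obtain F q where "p = F # q"
      by (cases p) (auto simp: weak_chains_def)
    with p show "p \<in> multichains (Suc N) \<Delta> \<union> (#) {} ` weak_chains N \<Delta>"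
      by (cases "F = {}") (auto simp: weak_chains_def multichains_def)
  next
    fix p assume "p \<in> multichains (Suc N) \<Delta> \<union> (#) {} ` weak_chains N \<Delta>"
    then show "p \<in> weak_chains (Suc N) \<Delta>"
      using assms(2) sub by (auto simp: weak_chains_def abstract_simplicial_complex_def)
  qed
  have "card (weak_chains (Suc N) \<Delta>) = card (multichains (Suc N) \<Delta>) + card ((#) {} ` weak_chains N \<Delta>)"
    unfolding eq using assms(1)
    by (intro card_Un_disjoint finite_imageI finite_weak_chains
          finite_subset[OF sub]) (auto simp: multichains_def)
  also have "card ((#) {} ` weak_chains N \<Delta>) = card (weak_chains N \<Delta>)"
    by (intro card_image) (auto simp: inj_on_def)
  finally show ?thesis
    using assms by (simp add: card_weak_chains)
qed

section \<open>Evaluating the identity that defines the h-vector\<close>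

lemma one_minus_X_times_X_div:
  "(1 - fps_X :: rat fps) * (fps_X / (1 - fps_X)) = fps_X"
  by (simp add: fps_divide_unit mult.left_commute inverse_mult_eq_1')

lemma card_le_of_complex_dim:
  assumes "finite \<Gamma>" "complex_dim \<Gamma> = int d - 1" "F \<in> \<Gamma>"
  shows "card F \<le> d"
  using assms Max_ge[of "card ` \<Gamma>" "card F"] by (simp add: complex_dim_def)

lemma sum_face_count:
  fixes f :: "nat \<Rightarrow> 'b::comm_semiring_1"
  assumes "finite \<Gamma>" "complex_dim \<Gamma> = int d - 1"
  shows "(\<Sum>i=0..d. of_nat (face_count \<Gamma> i) * f i) = (\<Sum>F\<in>\<Gamma>. f (card F))"
proof -
  have "(\<Sum>F\<in>\<Gamma>. f (card F)) = (\<Sum>i=0..d. \<Sum>F\<in>{F \<in> \<Gamma>. card F = i}. f (card F))"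
    using assms card_le_of_complex_dim[OF assms]
    by (intro sum.group[symmetric]) auto
  then show ?thesis
    by (simp add: face_count_def)
qed

lemma h_series_eq_sum_faces:
  assumes "finite \<Gamma>" "complex_dim \<Gamma> = int d - 1"
  shows "h_series \<Gamma> = (1 - fps_X) ^ d * (\<Sum>F\<in>\<Gamma>. (fps_X / (1 - fps_X)) ^ card F)"
  using assms sum_face_count[OF assms, of "\<lambda>i. (fps_X / (1 - fps_X) :: rat fps) ^ i"]
  by (simp add: h_series_def)

text \<open>Clearing denominators in the defining series leaves polynomials on both sides. A formal
  power series cannot be evaluated at x, so the identity is transferred to \<open>poly\<close>
  through the injectivity of \<open>fps_of_poly\<close>.\<close>

lemma h_vector_polynomial_identity:
  fixes x :: rat
  assumes "finite \<Gamma>" "complex_dim \<Gamma> = int d - 1"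
  shows "(\<Sum>k=0..d. h_vector \<Gamma> k * x ^ k) = (\<Sum>F\<in>\<Gamma>. x ^ card F * (1 - x) ^ (d - card F))"
proof -
  define p q :: "rat poly" where
    "p = (\<Sum>k=0..d. [:h_vector \<Gamma> k:] * [:0, 1:] ^ k)"
    and "q = (\<Sum>F\<in>\<Gamma>. [:0, 1:] ^ card F * [:1, -1:] ^ (d - card F))"
  have lin: "fps_of_poly [:1, -1::rat:] = 1 - fps_X"
    by (simp add: fps_of_poly_pCons)
  have X: "fps_of_poly [:0, 1::rat:] = fps_X"
    by (simp add: fps_of_poly_pCons)
  have const: "fps_of_poly [:c:] = fps_const c" for c :: rat
    by (simp add: fps_of_poly_pCons)
  have "fps_of_poly p = h_series \<Gamma>"
    unfolding h_series_eq_sum[OF assms(2), symmetric] p_def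
    by (simp only: fps_of_poly_sum fps_of_poly_mult fps_of_poly_power const X)
  also have "\<dots> = (\<Sum>F\<in>\<Gamma>. fps_X ^ card F * (1 - fps_X) ^ (d - card F))"
    unfolding h_series_eq_sum_faces[OF assms] sum_distrib_left
  proof (intro sum.cong refl)
    fix F assume "F \<in> \<Gamma>"
    then have "card F \<le> d"
      using card_le_of_complex_dim[OF assms] by blast
    then have "(1 - fps_X :: rat fps) ^ d = (1 - fps_X) ^ (d - card F) * (1 - fps_X) ^ card F"
      by (simp flip: power_add)
    then show "(1 - fps_X :: rat fps) ^ d * (fps_X / (1 - fps_X)) ^ card F
        = fps_X ^ card F * (1 - fps_X) ^ (d - card F)"
      by (simp only: mult.assoc power_mult_distrib[symmetric] one_minus_X_times_X_div
            mult.commute[of "fps_X ^ card F"])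
  qed
  also have "\<dots> = fps_of_poly q"
    unfolding q_def by (simp only: fps_of_poly_sum fps_of_poly_mult fps_of_poly_power lin X)
  finally have "poly p x = poly q x"
    by (simp add: fps_of_poly_eq_iff)
  then show ?thesis
    by (simp add: p_def q_def poly_sum)
qed

text \<open>Substitute y = x / (x + 1) into the polynomial identity, where 1 - y = 1 / (x + 1), and
  multiply by (x + 1) ^ d. The sign condition keeps x + 1 nonzero.\<close>

lemma sum_power_card_eq_h_vector:
  fixes x :: rat
  assumes "finite \<Gamma>" "complex_dim \<Gamma> = int d - 1" "x \<ge> 0"
  shows "(\<Sum>F\<in>\<Gamma>. x ^ card F) = (\<Sum>k=0..d. h_vector \<Gamma> k * (x ^ k * (x + 1) ^ (d - k)))"
proof -
  have scale: "(x + 1) ^ d * (x / (x + 1)) ^ k = x ^ k * (x + 1) ^ (d - k)" if "k \<le> d" for k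
    using that assms(3) by (simp add: power_divide power_diff)
  have "(\<Sum>k=0..d. h_vector \<Gamma> k * (x ^ k * (x + 1) ^ (d - k)))
      = (\<Sum>k=0..d. h_vector \<Gamma> k * ((x + 1) ^ d * (x / (x + 1)) ^ k))"
    using scale by (intro sum.cong) auto
  also have "\<dots> = (x + 1) ^ d * (\<Sum>k=0..d. h_vector \<Gamma> k * (x / (x + 1)) ^ k)"
    by (simp add: sum_distrib_left mult_ac)
  also have "\<dots> = (\<Sum>F\<in>\<Gamma>. (x + 1) ^ d * ((x / (x + 1)) ^ card F * (1 - x / (x + 1)) ^ (d - card F)))"
    by (simp only: h_vector_polynomial_identity[OF assms(1,2)] sum_distrib_left)
  also have "\<dots> = (\<Sum>F\<in>\<Gamma>. x ^ card F)"
  proof (intro sum.cong refl)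
    fix F assume "F \<in> \<Gamma>"
    then have le: "card F \<le> d"
      using card_le_of_complex_dim[OF assms(1,2)] by blast
    have "1 - x / (x + 1) = 1 / (x + 1)"
      using assms(3) by (simp add: field_simps)
    then have "(x + 1) ^ d * ((x / (x + 1)) ^ card F * (1 - x / (x + 1)) ^ (d - card F))
        = x ^ card F * (x + 1) ^ (d - card F) * (1 / (x + 1)) ^ (d - card F)"
      by (simp only: scale[OF le] mult.assoc[symmetric])
    then show "(x + 1) ^ d * ((x / (x + 1)) ^ card F * (1 - x / (x + 1)) ^ (d - card F)) = x ^ card F"
      using assms(3) by (simp add: power_divide)
  qed
  finally show ?thesis ..
qed

section \<open>Cliques of interlaced multichains\<close>

text \<open>A rank function for interlacing, which need not be transitive itself. Interlacing
  implies termwise inclusion, so the weight orients every edge of the graph and sorting a clique by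
  weight puts it in interlacing order.\<close>

definition weight :: "nat \<Rightarrow> 'a set list \<Rightarrow> nat" where
  "weight r p = (\<Sum>t<r. card (p ! t))"

lemma multichains_nth:
  assumes "p \<in> multichains r \<Delta>" "t < r"
  shows "p ! t \<in> \<Delta>" "p ! t \<noteq> {}"
proof -
  have "p ! t \<in> set p"
    using assms by (simp add: multichains_def)
  then show "p ! t \<in> \<Delta>" "p ! t \<noteq> {}"
    using assms(1) unfolding multichains_def by blast+
qed

lemma finite_multichains:
  assumes "finite \<Delta>"
  shows "finite (multichains r \<Delta>)"
  by (rule finite_subset[OF _ finite_lists_length_eq[OF assms, of r]]) (auto simp: multichains_def)

lemma interlace_le_refl:
  assumes "p \<in> multichains r \<Delta>"
  shows "interlace_le r p p"
proof -
  have "p ! s \<subseteq> p ! t" if "s \<le> t" "t < r" for s t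
    using assms that by (cases "s = t") (auto simp: multichains_def sorted_wrt_iff_nth_less)
  then show ?thesis
    by (simp add: interlace_le_def)
qed

lemma interlace_le_nth_subset: "interlace_le r p q \<Longrightarrow> t < r \<Longrightarrow> p ! t \<subseteq> q ! t"
  by (simp add: interlace_le_def)

lemma interlace_le_antisym:
  assumes "interlace_le r p q" "interlace_le r q p" "length p = r" "length q = r"
  shows "p = q"
  using assms by (intro nth_equalityI) (auto dest: interlace_le_nth_subset)

lemma weight_mono:
  assumes "interlace_le r p q" "q \<in> multichains r \<Delta>" "\<And>F. F \<in> \<Delta> \<Longrightarrow> finite F"
  shows "weight r p \<le> weight r q"
  unfolding weight_def using assms multichains_nth(1)[OF assms(2)]
  by (intro sum_mono card_mono) (auto dest: interlace_le_nth_subset)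

text \<open>Equal sums of termwise comparable cardinalities agree term by term, and nested finite
  sets of equal size coincide.\<close>

lemma interlace_le_weight_eqD:
  assumes "interlace_le r p q" "p \<in> multichains r \<Delta>" "q \<in> multichains r \<Delta>"
    and fin: "\<And>F. F \<in> \<Delta> \<Longrightarrow> finite F"
    and "weight r p = weight r q"
  shows "p = q"
proof (intro nth_equalityI)
  show "length p = length q"
    using assms by (simp add: multichains_def)
  fix t assume "t < length p"
  then have t: "t < r"
    using assms by (simp add: multichains_def)
  have le: "card (p ! s) \<le> card (q ! s)" if "s < r" for s
    using that assms(1) multichains_nth(1)[OF assms(3) that] fin
    by (intro card_mono) (auto dest: interlace_le_nth_subset)
  have "card (p ! t) = card (q ! t)"
    by (rule sum_mono_inv[of _ "{..<r}"]) (use assms(5) le t in \<open>auto simp: weight_def\<close>)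
  then show "p ! t = q ! t"
    using t assms(1) multichains_nth(1)[OF assms(3) t] fin
    by (intro card_subset_eq) (auto dest: interlace_le_nth_subset)
qed

lemma interlace_le_if_weight_le:
  assumes "interlace_le r p q \<or> interlace_le r q p" "p \<in> multichains r \<Delta>" "q \<in> multichains r \<Delta>"
    and fin: "\<And>F. F \<in> \<Delta> \<Longrightarrow> finite F"
    and "weight r p \<le> weight r q"
  shows "interlace_le r p q"
proof (rule ccontr)
  assume not_le: "\<not> interlace_le r p q"
  then have le: "interlace_le r q p"
    using assms(1) by blast
  then have "weight r q = weight r p"
    using weight_mono[OF le assms(2) fin] assms(5) by simp
  then have "q = p"
    using interlace_le_weight_eqD[OF le assms(3,2)] fin by blast
  then show False
    using not_le interlace_le_refl[OF assms(2)] by simp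
qed

text \<open>Interlacing bounds \<open>q ! t\<close> by \<open>p ! (t + 1)\<close>, so the difference of the weights telescopes.\<close>

lemma weight_bound:
  assumes "interlace_le r p q" "p \<in> multichains r \<Delta>" "q \<in> multichains r \<Delta>"
    and fin: "\<And>F. F \<in> \<Delta> \<Longrightarrow> finite F"
    and card: "\<And>F. F \<in> \<Delta> \<Longrightarrow> card F \<le> d"
    and "r \<ge> 1"
  shows "weight r q < weight r p + d"
proof -
  obtain s where s: "r = Suc s"
    using assms(6) by (cases r) auto
  have "weight r q = (\<Sum>t<s. card (q ! t)) + card (q ! s)"
    by (simp add: weight_def s)
  also have "\<dots> \<le> (\<Sum>t<s. card (p ! Suc t)) + d"
  proof (intro add_mono sum_mono card_mono)
    fix t assume t: "t \<in> {..<s}"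
    then show "finite (p ! Suc t)" "q ! t \<subseteq> p ! Suc t"
      using s assms(1) fin multichains_nth(1)[OF assms(2)] by (auto simp: interlace_le_def)
  next
    show "card (q ! s) \<le> d"
      using s card multichains_nth(1)[OF assms(3)] by auto
  qed
  \<comment> \<open>The inequality is strict because \<open>p ! 0\<close> is nonempty. This is what
    bounds a clique by d elements instead of d + 1.\<close>
  also have "\<dots> < card (p ! 0) + (\<Sum>t<s. card (p ! Suc t)) + d"
    using s fin multichains_nth[OF assms(2), of 0] by (simp add: card_gt_0_iff)
  also have "card (p ! 0) + (\<Sum>t<s. card (p ! Suc t)) = weight r p"
    unfolding weight_def s by (rule sum.lessThan_Suc_shift[symmetric])
  finally show ?thesis .
qed

text \<open>Finiteness of K is automatic, and reflexivity of interlacing absorbs the condition that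
  the two vertices be distinct.\<close>

lemma multichain_complex_iff:
  assumes "finite \<Delta>"
  shows "K \<in> multichain_complex r \<Delta> \<longleftrightarrow> K \<subseteq> multichains r \<Delta> \<and>
    (\<forall>p\<in>K. \<forall>q\<in>K. interlace_le r p q \<or> interlace_le r q p)"
proof (cases "K \<subseteq> multichains r \<Delta>")
  case True
  then have "finite K" and "\<forall>p\<in>K. interlace_le r p p"
    using finite_subset[OF _ finite_multichains[OF assms]] interlace_le_refl by blast+
  with True show ?thesis
    unfolding multichain_complex_def clique_complex_def mem_Collect_eq by metis
qed (simp add: multichain_complex_def clique_complex_def)

lemma finite_multichain_complex:
  assumes "finite \<Delta>"
  shows "finite (multichain_complex r \<Delta>)"
  by (rule finite_subset[of _ "Pow (multichains r \<Delta>)"])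
    (auto simp: multichain_complex_iff[OF assms] finite_multichains[OF assms])

text \<open>The weights of a clique are pairwise distinct, and by \<open>weight_bound\<close> they
  all lie in an interval of d integers starting at the least one.\<close>

lemma card_clique_le:
  assumes "finite \<Delta>" and fin: "\<And>F. F \<in> \<Delta> \<Longrightarrow> finite F"
    and card: "\<And>F. F \<in> \<Delta> \<Longrightarrow> card F \<le> d"
    and "r \<ge> 1" and K: "K \<in> multichain_complex r \<Delta>"
  shows "card K \<le> d"
proof (cases "K = {}")
  case False
  have sub: "K \<subseteq> multichains r \<Delta>"
    and adj: "\<And>p q. p \<in> K \<Longrightarrow> q \<in> K \<Longrightarrow> interlace_le r p q \<or> interlace_le r q p"
    using K by (auto simp: multichain_complex_iff[OF assms(1)])
  obtain p where p: "p \<in> K" "\<And>q. q \<in> K \<Longrightarrow> weight r p \<le> weight r q"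
    using False arg_min_nat_lemma[of "\<lambda>p. p \<in> K" _ "weight r"] by blast
  have inj: "inj_on (weight r) K"
  proof
    fix p q assume pq: "p \<in> K" "q \<in> K" "weight r p = weight r q"
    then have "p \<in> multichains r \<Delta>" "q \<in> multichains r \<Delta>"
      using sub by auto
    then show "p = q"
      using adj[OF pq(1,2)] pq(3)
        interlace_le_weight_eqD[of r p q \<Delta>] interlace_le_weight_eqD[of r q p \<Delta>] fin
      by auto
  qed
  have le: "interlace_le r p q" if q: "q \<in> K" for q
    by (rule interlace_le_if_weight_le[OF adj[OF p(1) q] _ _ fin p(2)[OF q]])
      (use p(1) q sub in auto)
  have "weight r ` K \<subseteq> {weight r p..<weight r p + d}"
  proof
    fix w assume "w \<in> weight r ` K"
    then obtain q where q: "q \<in> K" "w = weight r q"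
      by blast
    have "weight r q < weight r p + d"
      by (rule weight_bound[OF le[OF q(1)] _ _ fin card assms(4)]) (use p(1) q(1) sub in auto)
    then show "w \<in> {weight r p..<weight r p + d}"
      using p(2) q by simp
  qed
  from card_mono[OF _ this] have "card (weight r ` K) \<le> d"
    by simp
  then show ?thesis
    using card_image[OF inj] by simp
qed simp

lemma ex_clique_of_card:
  assumes "finite \<Delta>" "abstract_simplicial_complex \<Delta>" "F \<in> \<Delta>" "r \<ge> 1"
  shows "\<exists>K \<in> multichain_complex r \<Delta>. card K = card F"
proof -
  obtain s where s: "r = Suc s"
    using assms(4) by (cases r) auto
  have "finite F" and down: "\<And>G. G \<subseteq> F \<Longrightarrow> G \<in> \<Delta>"
    using assms by (auto simp: abstract_simplicial_complex_def)
  then obtain h where h: "bij_betw h {0..<card F} F"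
    using ex_bij_betw_nat_finite by blast
  \<comment> \<open>With the elements of F enumerated by h, the first entry runs through the
    nonempty initial segments and all other entries are F. Only the first entries vary, so
    interlacing reduces to their inclusion.\<close>
  define P where "P i = h ` {0..i} # replicate s F" for i
  have sub: "h ` {0..i} \<subseteq> F" if "i < card F" for i
    using h that by (auto simp: bij_betw_def)
  have inj: "inj_on P {0..<card F}"
  proof
    fix i j assume ij: "i \<in> {0..<card F}" "j \<in> {0..<card F}" and "P i = P j"
    then have "h ` {0..i} = h ` {0..j}"
      by (simp add: P_def)
    moreover have "inj_on h {0..<card F}"
      using h by (simp add: bij_betw_def)
    ultimately have "{0..i} = {0..j}"
      using ij by (subst (asm) inj_on_image_eq_iff) auto
    then show "i = j"
      by simp
  qed
  have "P i \<in> multichains r \<Delta>" if "i < card F" for i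
    using sub[OF that] down by (auto simp: multichains_def P_def s sorted_wrt_iff_nth_less nth_Cons')
  moreover have "interlace_le r (P i) (P j)" if "i \<le> j" "j < card F" for i j
    using that sub by (auto simp: interlace_le_def P_def s nth_Cons')
  ultimately have "P ` {0..<card F} \<in> multichain_complex r \<Delta>"
    by (auto simp: multichain_complex_iff[OF assms(1)]) (metis nle_le)
  moreover have "card (P ` {0..<card F}) = card F"
    using inj by (simp add: card_image)
  ultimately show ?thesis
    by blast
qed

text \<open>\<open>h_series\<close> reads its exponent off the dimension, so both complexes must
  yield the same d. The preceding two lemmas give the upper bound and a clique attaining it.\<close>

lemma complex_dim_multichain_complex:
  assumes "finite \<Delta>" "abstract_simplicial_complex \<Delta>" "r \<ge> 1"
  shows "complex_dim (multichain_complex r \<Delta>) = complex_dim \<Delta>"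
proof -
  have fin: "\<And>F. F \<in> \<Delta> \<Longrightarrow> finite F" and ne: "\<Delta> \<noteq> {}"
    using assms by (auto simp: abstract_simplicial_complex_def)
  define d where "d = Max (card ` \<Delta>)"
  have card: "\<And>F. F \<in> \<Delta> \<Longrightarrow> card F \<le> d"
    using assms(1) by (simp add: d_def)
  have "d \<in> card ` \<Delta>"
    unfolding d_def using assms(1) ne by (intro Max_in) auto
  then obtain K where "K \<in> multichain_complex r \<Delta>" "card K = d"
    using ex_clique_of_card[OF assms(1,2) _ assms(3)] by blast
  then have "Max (card ` multichain_complex r \<Delta>) = d"
    using card_clique_le[OF assms(1) fin card assms(3)] finite_multichain_complex[OF assms(1)]
    by (intro Max_eqI) auto
  then show ?thesis
    by (simp add: complex_dim_def d_def)
qed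

section \<open>Multisets supported on faces\<close>

lemma X_div_one_minus_X_nth:
  "fps_nth (fps_X / (1 - fps_X) :: rat fps) n = (if n = 0 then 0 else 1)"
proof -
  have "inverse (1 - fps_X :: rat fps) = Abs_fps (\<lambda>_. 1)"
    by (rule fps_inverse_unique) (simp add: fps_eq_iff left_diff_distrib)
  then have "(fps_X / (1 - fps_X) :: rat fps) = fps_X * Abs_fps (\<lambda>_. 1)"
    by (simp add: fps_divide_unit)
  then show ?thesis
    by simp
qed

lemma finite_multisets_of_size:
  assumes "finite F"
  shows "finite {M. set_mset M = F \<and> size M = j}"
proof (rule finite_subset)
  show "{M. set_mset M = F \<and> size M = j} \<subseteq> mset ` {xs. set xs \<subseteq> F \<and> length xs = j}"
  proof
    fix M assume "M \<in> {M. set_mset M = F \<and> size M = j}"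
    moreover obtain xs where "mset xs = M"
      using ex_mset by blast
    ultimately show "M \<in> mset ` {xs. set xs \<subseteq> F \<and> length xs = j}"
      by auto
  qed
  show "finite (mset ` {xs. set xs \<subseteq> F \<and> length xs = j})"
    using assms by (simp add: finite_lists_length_eq)
qed

text \<open>Each element of F occurs with a positive multiplicity and so contributes a factor t +
  t^2 + ... = t / (1 - t). The induction step splits a multiset by the multiplicity c of the new
  element x, which is a Cauchy product.\<close>

lemma card_multisets_with_support:
  assumes "finite F"
  shows "of_nat (card {M. set_mset M = F \<and> size M = j}) = fps_nth ((fps_X / (1 - fps_X) :: rat fps) ^ card F) j"
  using assms
proof (induction F arbitrary: j rule: finite_induct)
  case empty
  have "{M :: 'a multiset. set_mset M = {} \<and> size M = j} = (if j = 0 then {{#}} else {})"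
    by auto
  then show ?case
    by simp
next
  case (insert x F)
  let ?S = "\<lambda>c. {M. set_mset M = F \<and> size M = j - c}"
  let ?f = "\<lambda>(c, M). replicate_mset c x + M"
  have "{M. set_mset M = insert x F \<and> size M = j} = ?f ` Sigma {1..j} ?S"
  proof (intro equalityI subsetI)
    fix M assume M: "M \<in> {M. set_mset M = insert x F \<and> size M = j}"
    have "M = replicate_mset (count M x) x + filter_mset (\<lambda>y. y \<noteq> x) M"
      by (rule multiset_eqI) auto
    moreover have "set_mset (filter_mset (\<lambda>y. y \<noteq> x) M) = F"
      using M insert.hyps by auto
    moreover have "size (filter_mset (\<lambda>y. y \<noteq> x) M) = j - count M x"
      using M arg_cong[OF calculation(1), of size] by auto
    moreover have "count M x \<in> {1..j}"
      using M count_le_size[of M x] by (auto simp flip: count_greater_zero_iff)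
    ultimately show "M \<in> ?f ` Sigma {1..j} ?S"
      by (intro image_eqI[of _ _ "(count M x, filter_mset (\<lambda>y. y \<noteq> x) M)"]) auto
  qed (auto split: if_splits)
  moreover have "inj_on ?f (Sigma {1..j} ?S)"
  proof (rule inj_onI, clarify)
    fix c c' M M'
    assume eq: "replicate_mset c x + M = replicate_mset c' x + M'" and F: "F = set_mset M" "set_mset M' = set_mset M"
    then have "count M x = 0" "count M' x = 0"
      using insert.hyps by (auto simp: count_eq_zero_iff)
    with arg_cong[OF eq, of "\<lambda>A. count A x"] have "c = c'"
      by simp
    with eq show "c = c' \<and> M = M'"
      by simp
  qed
  ultimately have "card {M. set_mset M = insert x F \<and> size M = j} = (\<Sum>c=1..j. card (?S c))"
    using insert.hyps by (simp add: card_image finite_multisets_of_size)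
  then have "of_nat (card {M. set_mset M = insert x F \<and> size M = j})
      = (\<Sum>c=1..j. fps_nth ((fps_X / (1 - fps_X) :: rat fps) ^ card F) (j - c))"
    using insert.IH by simp
  also have "\<dots> = (\<Sum>c=0..j. fps_nth (fps_X / (1 - fps_X) :: rat fps) c
      * fps_nth ((fps_X / (1 - fps_X)) ^ card F) (j - c))"
    by (intro sum.mono_neutral_cong_left) (auto simp: X_div_one_minus_X_nth)
  also have "\<dots> = fps_nth ((fps_X / (1 - fps_X)) ^ card (insert x F)) j"
    using insert.hyps by (simp add: fps_mult_nth)
  finally show ?case .
qed

text \<open>The multisets supported on a face are the nonzero monomials of the Stanley-Reisner ring.
  Grouping them by support gives its Hilbert series.\<close>

lemma multiset_generating_function:
  assumes "finite \<Gamma>" "\<And>F. F \<in> \<Gamma> \<Longrightarrow> finite F"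
  shows "(\<Sum>F\<in>\<Gamma>. (fps_X / (1 - fps_X) :: rat fps) ^ card F)
    = Abs_fps (\<lambda>j. of_nat (card {M. set_mset M \<in> \<Gamma> \<and> size M = j}))"
proof (rule fps_ext)
  fix j
  have "{M. set_mset M \<in> \<Gamma> \<and> size M = j} = (\<Union>F\<in>\<Gamma>. {M. set_mset M = F \<and> size M = j})"
    by auto
  then have "card {M. set_mset M \<in> \<Gamma> \<and> size M = j} = (\<Sum>F\<in>\<Gamma>. card {M. set_mset M = F \<and> size M = j})"
    using assms by (simp only:) (intro card_UN_disjoint, auto intro: finite_multisets_of_size)
  then show "fps_nth (\<Sum>F\<in>\<Gamma>. (fps_X / (1 - fps_X) :: rat fps) ^ card F) j
      = fps_nth (Abs_fps (\<lambda>j. of_nat (card {M. set_mset M \<in> \<Gamma> \<and> size M = j}))) j"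
    using assms(2) by (simp add: fps_sum_nth card_multisets_with_support)
qed

section \<open>From multisets of multichains to single long multichains\<close>

definition interlaced_lists :: "nat \<Rightarrow> nat \<Rightarrow> 'a set set \<Rightarrow> 'a set list list set" where
  "interlaced_lists r j \<Delta> =
     {P. length P = j \<and> set P \<subseteq> multichains r \<Delta> \<and> sorted_wrt (interlace_le r) P}"

text \<open>If the heads x and y differed, each would occur behind the other in one of the lists,
  and antisymmetry would identify them. Transitivity is avoided because interlacing lacks it:
  \<open>sorted_wrt\<close> relates all pairs, not just neighbours.\<close>

lemma sorted_wrt_mset_unique:
  assumes "sorted_wrt R xs" "sorted_wrt R ys" "mset xs = mset ys"
    and antisym: "\<And>x y. x \<in> set xs \<Longrightarrow> y \<in> set xs \<Longrightarrow> R x y \<Longrightarrow> R y x \<Longrightarrow> x = y"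
  shows "xs = ys"
  using assms
proof (induction xs arbitrary: ys)
  case (Cons x xs)
  then obtain y ys' where ys: "ys = y # ys'"
    by (cases ys) auto
  have set_eq: "set (x # xs) = set ys"
    using Cons.prems(3) by (metis set_mset_mset)
  have "x = y"
  proof (rule ccontr)
    assume "x \<noteq> y"
    then have "x \<in> set ys'" "y \<in> set xs"
      using set_eq by (auto simp: ys)
    then have "R x y" "R y x"
      using Cons.prems by (auto simp: ys)
    then show False
      using Cons.prems(4) \<open>x \<noteq> y\<close> \<open>y \<in> set xs\<close> by auto
  qed
  moreover have "xs = ys'"
    using Cons \<open>x = y\<close> by (auto simp: ys)
  ultimately show ?case
    by (simp add: ys)
qed simp

lemma bij_betw_interlaced_lists:
  assumes "finite \<Delta>" and fin: "\<And>F. F \<in> \<Delta> \<Longrightarrow> finite F"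
  shows "bij_betw mset (interlaced_lists r j \<Delta>)
    {M. set_mset M \<in> multichain_complex r \<Delta> \<and> size M = j}"
proof (rule bij_betw_imageI)
  show "inj_on mset (interlaced_lists r j \<Delta>)"
  proof
    fix P Q assume *: "P \<in> interlaced_lists r j \<Delta>" "Q \<in> interlaced_lists r j \<Delta>" "mset P = mset Q"
    show "P = Q"
      by (rule sorted_wrt_mset_unique[of "interlace_le r"])
        (use * in \<open>auto simp: interlaced_lists_def multichains_def intro!: interlace_le_antisym[of r]\<close>)
  qed
  show "mset ` interlaced_lists r j \<Delta> = {M. set_mset M \<in> multichain_complex r \<Delta> \<and> size M = j}"
  proof (intro equalityI subsetI)
    fix M assume "M \<in> mset ` interlaced_lists r j \<Delta>"
    then obtain P where P: "M = mset P" "length P = j" "set P \<subseteq> multichains r \<Delta>"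
      "sorted_wrt (interlace_le r) P"
      by (auto simp: interlaced_lists_def)
    have "interlace_le r p q \<or> interlace_le r q p" if pq: "p \<in> set P" "q \<in> set P" for p q
    proof -
      obtain a b where "a < length P" "b < length P" "p = P ! a" "q = P ! b"
        using pq by (metis in_set_conv_nth)
      then show ?thesis
        using P(4) interlace_le_refl[of p r \<Delta>] subsetD[OF P(3) pq(1)]
        by (cases a b rule: linorder_cases) (auto simp: sorted_wrt_iff_nth_less)
    qed
    then show "M \<in> {M. set_mset M \<in> multichain_complex r \<Delta> \<and> size M = j}"
      using P by (auto simp: multichain_complex_iff[OF assms(1)])
  next
    fix M assume M: "M \<in> {M. set_mset M \<in> multichain_complex r \<Delta> \<and> size M = j}"
    obtain xs where xs: "mset xs = M"
      using ex_mset by blast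
    define P where "P = sort_key (weight r) xs"
    have "mset P = M"
      by (simp add: P_def xs)
    then have set_P: "set P = set_mset M" and len: "length P = j"
      using M by (auto simp flip: size_mset)
    have sub: "set P \<subseteq> multichains r \<Delta>"
      and adj: "\<And>p q. p \<in> set P \<Longrightarrow> q \<in> set P \<Longrightarrow> interlace_le r p q \<or> interlace_le r q p"
      using M by (auto simp: set_P multichain_complex_iff[OF assms(1)])
    \<comment> \<open>Sorting by weight produces a list with the prescribed multiset. Any two
      members of a clique are comparable, so the order of weights is the interlacing order.\<close>
    have "sorted_wrt (\<lambda>p q. weight r p \<le> weight r q) P"
      using sorted_sort_key[of "weight r" xs] by (simp add: P_def sorted_wrt_map)
    moreover have "interlace_le r p q" if "p \<in> set P" "q \<in> set P" "weight r p \<le> weight r q" for p q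
      by (rule interlace_le_if_weight_le[OF adj[OF that(1,2)] _ _ fin that(3)])
        (use that sub in auto)
    ultimately have "sorted_wrt (interlace_le r) P"
      by (rule sorted_wrt_mono_rel[rotated])
    then show "M \<in> mset ` interlaced_lists r j \<Delta>"
      using \<open>mset P = M\<close> sub len by (auto simp: interlaced_lists_def)
  qed
qed

text \<open>
  Reading the chain \<open>p\<^sub>1 ! 0 \<subseteq> p\<^sub>2 ! 0 \<subseteq> \<dots> \<subseteq> p\<^sub>j ! 0 \<subseteq> p\<^sub>1 ! 1 \<subseteq> \<dots> \<subseteq> p\<^sub>j ! (r - 1)\<close> as one list.
\<close>

lemma bij_betw_reshape:
  "bij_betw (\<lambda>P. map (\<lambda>x. P ! (x mod j) ! (x div j)) [0..<r * j])
     (interlaced_lists r j \<Delta>) (multichains (r * j) \<Delta>)"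
\<comment> \<open>Position t * j + i of the long chain holds entry t of the i-th multichain, so
  \<open>div\<close> and \<open>mod\<close> by j recover t and i.\<close>
proof (rule bij_betw_byWitness[where f' = "\<lambda>L. map (\<lambda>i. map (\<lambda>t. L ! (t * j + i)) [0..<r]) [0..<j]"])
  have idx: "t * j + i < r * j" if "i < j" "t < r" for i t
  proof -
    have "t * j + i < Suc t * j"
      using that by simp
    also have "\<dots> \<le> r * j"
      using that by (intro mult_le_mono1) simp
    finally show ?thesis .
  qed
  have dm: "x mod j < j" "x div j < r" if "x < r * j" for x
    using that by (auto intro!: mod_less_divisor less_mult_imp_div_less) (cases j, auto)
  show "\<forall>P\<in>interlaced_lists r j \<Delta>. map (\<lambda>i. map (\<lambda>t. map (\<lambda>x. P ! (x mod j) ! (x div j)) [0..<r * j]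
          ! (t * j + i)) [0..<r]) [0..<j] = P"
  proof
    fix P assume P: "P \<in> interlaced_lists r j \<Delta>"
    have "length (P ! i) = r" if "i < j" for i
    proof -
      have "P ! i \<in> multichains r \<Delta>"
        using P that nth_mem[of i P] unfolding interlaced_lists_def by blast
      then show ?thesis
        by (simp add: multichains_def)
    qed
    then show "map (\<lambda>i. map (\<lambda>t. map (\<lambda>x. P ! (x mod j) ! (x div j)) [0..<r * j]
          ! (t * j + i)) [0..<r]) [0..<j] = P"
      using P by (intro nth_equalityI) (auto simp: interlaced_lists_def idx intro!: nth_equalityI)
  qed
  show "\<forall>L\<in>multichains (r * j) \<Delta>. map (\<lambda>x. map (\<lambda>i. map (\<lambda>t. L ! (t * j + i)) [0..<r]) [0..<j]
          ! (x mod j) ! (x div j)) [0..<r * j] = L"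
    by (auto simp: multichains_def dm intro!: nth_equalityI)
  show "(\<lambda>P. map (\<lambda>x. P ! (x mod j) ! (x div j)) [0..<r * j]) ` interlaced_lists r j \<Delta>
      \<subseteq> multichains (r * j) \<Delta>"
  proof clarify
    fix P assume P: "P \<in> interlaced_lists r j \<Delta>"
    let ?L = "map (\<lambda>x. P ! (x mod j) ! (x div j)) [0..<r * j]"
    have mc: "P ! i \<in> multichains r \<Delta>" if "i < j" for i
      using P that nth_mem[of i P] unfolding interlaced_lists_def by blast
    have le: "interlace_le r (P ! i) (P ! i')" if "i \<le> i'" "i' < j" for i i'
      using P that interlace_le_refl[OF mc[OF that(2)]]
      by (cases "i = i'") (auto simp: interlaced_lists_def sorted_wrt_iff_nth_less)
    have "P ! (x mod j) ! (x div j) \<subseteq> P ! (y mod j) ! (y div j)" if xy: "x < y" "y < r * j" for x y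
    \<comment> \<open>The two cases use the two halves of interlacing. If the later position y
      belongs to an earlier multichain, its entry index is strictly larger, and the superset
      condition applies with the multichains exchanged.\<close>
    proof (cases "x mod j \<le> y mod j")
      case True
      have "x div j \<le> y div j"
        using xy by (intro div_le_mono) simp
      with True show ?thesis
        using le[OF True] dm[of y] dm[of x] xy by (auto simp: interlace_le_def)
    next
      case False
      then have "x div j < y div j"
        using xy div_le_mono[of x y j] div_mult_mod_eq[of x j] div_mult_mod_eq[of y j]
        by (cases "x div j = y div j") auto
      with False show ?thesis
        using le[of "y mod j" "x mod j"] dm[of y] dm[of x] xy by (auto simp: interlace_le_def)
    qed
    moreover have "P ! (x mod j) ! (x div j) \<in> \<Delta> - {{}}" if "x < r * j" for x
      using multichains_nth[OF mc] dm[OF that] by auto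
    ultimately show "?L \<in> multichains (r * j) \<Delta>"
      unfolding multichains_def sorted_wrt_iff_nth_less by auto
  qed
  show "(\<lambda>L. map (\<lambda>i. map (\<lambda>t. L ! (t * j + i)) [0..<r]) [0..<j]) ` multichains (r * j) \<Delta>
      \<subseteq> interlaced_lists r j \<Delta>"
  proof clarify
    fix L assume L: "L \<in> multichains (r * j) \<Delta>"
    let ?P = "map (\<lambda>i. map (\<lambda>t. L ! (t * j + i)) [0..<r]) [0..<j]"
    have sorted: "L ! x \<subseteq> L ! y" if "x \<le> y" "y < r * j" for x y
      using L that by (cases "x = y") (auto simp: multichains_def sorted_wrt_iff_nth_less)
    \<comment> \<open>\<open>le1\<close> and \<open>le2\<close> are the two halves of interlacing:
      moving to the same or a later block with i not decreasing, and moving to a strictly later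
      block with any i.\<close>
    have le1: "L ! (s * j + i) \<subseteq> L ! (t * j + i')" if "s \<le> t" "i \<le> i'" "i' < j" "t < r" for s t i i'
      using that idx by (intro sorted add_mono mult_le_mono1) auto
    have le2: "L ! (s * j + i) \<subseteq> L ! (t * j + i')" if "s < t" "i < j" "i' < j" "t < r" for s t i i'
    proof (rule sorted)
      have "s * j + i \<le> Suc s * j"
        using that by simp
      also have "\<dots> \<le> t * j"
        using that by (intro mult_le_mono1) simp
      finally show "s * j + i \<le> t * j + i'"
        by simp
    qed (use that idx in auto)
    have "map (\<lambda>t. L ! (t * j + i)) [0..<r] \<in> multichains r \<Delta>" if "i < j" for i
      using multichains_nth[OF L idx[OF that]] le1 that
      by (auto simp: multichains_def sorted_wrt_iff_nth_less)
    moreover have "interlace_le r (map (\<lambda>t. L ! (t * j + i)) [0..<r]) (map (\<lambda>t. L ! (t * j + i')) [0..<r])"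
      if "i < i'" "i' < j" for i i'
      using that le1 le2 by (simp add: interlace_le_def)
    ultimately show "?P \<in> interlaced_lists r j \<Delta>"
      by (auto simp: interlaced_lists_def sorted_wrt_iff_nth_less)
  qed
qed

section \<open>Colored permutations and sorted sequences\<close>

text \<open>The quotient sequences, for a fixed set D of steps at which a rise is forced. The final
  value j becomes the exponent of the generating function.\<close>

definition heights :: "nat \<Rightarrow> nat set \<Rightarrow> nat \<Rightarrow> (nat \<Rightarrow> nat) set" where
  "heights n D j = {q \<in> {1..n} \<rightarrow>\<^sub>E UNIV. q 1 = 0 \<and> q n = j \<and>
     (\<forall>i\<in>{1..<n}. q i + of_bool (i \<in> D) \<le> q (Suc i))}"

lemma heights_1: "heights (Suc 0) D j = (if j = 0 then {\<lambda>i\<in>{1}. 0} else {})"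
  by (auto simp: heights_def PiE_def extensional_def fun_eq_iff restrict_def)

lemma heights_Suc:
  assumes "n \<ge> 1"
  shows "heights (Suc n) D j
    = (\<lambda>q. q(Suc n := j)) ` (\<Union>i\<in>{i. i + of_bool (n \<in> D) \<le> j}. heights n D i)"
proof (intro equalityI subsetI)
  fix q assume q: "q \<in> heights (Suc n) D j"
  have "restrict q {1..n} \<in> heights n D (q n)"
    using assms q by (auto simp: heights_def)
  moreover have "\<forall>i\<in>{1..<Suc n}. q i + of_bool (i \<in> D) \<le> q (Suc i)" "q (Suc n) = j"
    using q by (auto simp: heights_def)
  then have "q n + of_bool (n \<in> D) \<le> j"
    using assms by fastforce
  moreover have "q = (restrict q {1..n})(Suc n := j)"
    using q by (auto simp: heights_def PiE_def extensional_def fun_eq_iff)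
  ultimately show "q \<in> (\<lambda>q. q(Suc n := j)) ` (\<Union>i\<in>{i. i + of_bool (n \<in> D) \<le> j}. heights n D i)"
    by blast
next
  fix q assume "q \<in> (\<lambda>q. q(Suc n := j)) ` (\<Union>i\<in>{i. i + of_bool (n \<in> D) \<le> j}. heights n D i)"
  then obtain i p where q: "q = p(Suc n := j)" and i: "i + of_bool (n \<in> D) \<le> j"
    and p: "p \<in> heights n D i"
    by blast
  have "q k + of_bool (k \<in> D) \<le> q (Suc k)" if "k \<in> {1..<Suc n}" for k
    using that i p by (cases "k = n") (auto simp: q heights_def)
  then show "q \<in> heights (Suc n) D j"
    using p assms by (auto simp: q heights_def PiE_def extensional_def)
qed

lemma finite_heights: "n \<ge> 1 \<Longrightarrow> finite (heights n D j)"
proof (induction n arbitrary: j rule: nat_induct_at_least)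
  case base
  then show ?case
    using heights_1[of D j] by simp
next
  case (Suc n)
  have "finite {i. i + of_bool (n \<in> D) \<le> j}"
    by (rule finite_subset[of _ "{..j}"]) auto
  then show ?case
    using Suc by (simp add: heights_Suc)
qed

lemma card_heights_Suc:
  assumes "n \<ge> 1"
  shows "card (heights (Suc n) D j) = (\<Sum>i | i + of_bool (n \<in> D) \<le> j. card (heights n D i))"
proof -
  have fin: "finite {i. i + of_bool (n \<in> D) \<le> j}"
    by (rule finite_subset[of _ "{..j}"]) auto
  have "inj_on (\<lambda>q. q(Suc n := j)) (\<Union>i\<in>{i. i + of_bool (n \<in> D) \<le> j}. heights n D i)"
  proof
    fix p q assume pq: "p \<in> (\<Union>i\<in>{i. i + of_bool (n \<in> D) \<le> j}. heights n D i)"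
      "q \<in> (\<Union>i\<in>{i. i + of_bool (n \<in> D) \<le> j}. heights n D i)"
      and eq: "p(Suc n := j) = q(Suc n := j)"
    have "p (Suc n) = q (Suc n)"
      using pq by (auto simp: heights_def PiE_def extensional_def)
    with eq show "p = q"
      by (metis fun_upd_triv fun_upd_upd)
  qed
  then have "card (heights (Suc n) D j) = card (\<Union>i\<in>{i. i + of_bool (n \<in> D) \<le> j}. heights n D i)"
    unfolding heights_Suc[OF assms] by (rule card_image)
  also have "\<dots> = (\<Sum>i | i + of_bool (n \<in> D) \<le> j. card (heights n D i))"
    using fin finite_heights[OF assms] by (intro card_UN_disjoint) (auto simp: heights_def)
  finally show ?thesis .
qed

text \<open>Such a sequence is given by n - 1 independent increments. A free increment contributes 1
  / (1 - t), and a forced one an additional factor t.\<close>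

lemma heights_generating_function:
  assumes "n \<ge> 1"
  shows "(1 - fps_X) ^ (n - 1) * Abs_fps (\<lambda>j. of_nat (card (heights n D j)) :: rat)
    = fps_X ^ card (D \<inter> {1..<n})"
  using assms
proof (induction n rule: nat_induct_at_least)
  case base
  have "Abs_fps (\<lambda>j. of_nat (card (heights (Suc 0) D j)) :: rat) = 1"
    by (simp add: fps_eq_iff heights_1)
  then show ?case
    by simp
next
  case (Suc n)
  let ?H = "\<lambda>n. Abs_fps (\<lambda>j. of_nat (card (heights n D j)) :: rat)"
  \<comment> \<open>The recursion expresses the counts as partial sums over the previous height, so
    multiplication by 1 - t leaves a single term, shifted by one at a forced rise.\<close>
  have step: "(1 - fps_X) * ?H (Suc n) = fps_X ^ of_bool (n \<in> D) * ?H n"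
  proof (rule fps_ext)
    fix j
    show "fps_nth ((1 - fps_X) * ?H (Suc n)) j = fps_nth (fps_X ^ of_bool (n \<in> D) * ?H n) j"
    proof (cases j)
      case 0
      have "{i :: nat. i = 0} = {0}"
        by auto
      then show ?thesis
        using 0 Suc.hyps by (auto simp: left_diff_distrib card_heights_Suc)
    next
      case (Suc k)
      have "{i. i \<le> Suc k} = insert (Suc k) {i. i \<le> k}" "{i. i \<le> k} = {..k}"
        "{i. Suc i \<le> k} = {..<k}" "{i. i < k} = {..<k}"
        by auto
      then show ?thesis
        using Suc \<open>n \<ge> 1\<close>
        by (auto simp: left_diff_distrib card_heights_Suc lessThan_Suc_atMost[symmetric])
    qed
  qed
  have "(1 - fps_X) ^ (Suc n - 1) * ?H (Suc n) = (1 - fps_X) ^ (n - 1) * ((1 - fps_X) * ?H (Suc n))"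
    using Suc.hyps by (cases n) (simp_all add: mult_ac)
  also have "\<dots> = fps_X ^ of_bool (n \<in> D) * ((1 - fps_X) ^ (n - 1) * ?H n)"
    by (simp only: step mult.left_commute)
  also have "\<dots> = fps_X ^ (of_bool (n \<in> D) + card (D \<inter> {1..<n}))"
    by (simp only: Suc.IH power_add)
  also have "of_bool (n \<in> D) + card (D \<inter> {1..<n}) = card (D \<inter> {1..<Suc n})"
    using Suc.hyps by (simp add: atLeastLessThanSuc)
  finally show ?case .
qed

section \<open>Sorting permutations with ties broken by position\<close>

definition lex_less :: "(nat \<Rightarrow> nat) \<Rightarrow> nat \<Rightarrow> nat \<Rightarrow> bool" where
  "lex_less g x y \<longleftrightarrow> g x < g y \<or> g x = g y \<and> x < y"

definition sorts :: "nat \<Rightarrow> (nat \<Rightarrow> nat) \<Rightarrow> (nat \<Rightarrow> nat) \<Rightarrow> bool" where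
  "sorts n \<sigma> g \<longleftrightarrow> \<sigma> permutes {1..n} \<and> (\<forall>i\<in>{1..<n}. lex_less g (\<sigma> i) (\<sigma> (Suc i)))"

lemma transp_lex_less: "transp (lex_less g)"
  by (auto simp: transp_def lex_less_def)

lemma sortsD:
  assumes "sorts n \<sigma> g" "1 \<le> i" "i < k" "k \<le> n"
  shows "lex_less g (\<sigma> i) (\<sigma> k)"
proof -
  have "Suc i \<le> k"
    using assms(3) by simp
  then show ?thesis
    using assms(4)
  proof (induction k rule: dec_induct)
    case base
    then show ?case
      using assms(1,2) by (simp add: sorts_def)
  next
    case (step m)
    then have "lex_less g (\<sigma> m) (\<sigma> (Suc m))"
      using assms(1,2) by (simp add: sorts_def)
    with step show ?case
      using transpD[OF transp_lex_less, of g "\<sigma> i" "\<sigma> m" "\<sigma> (Suc m)"] by simp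
  qed
qed

lemma sorts_mono:
  assumes "sorts n \<sigma> g" "1 \<le> i" "i \<le> k" "k \<le> n"
  shows "g (\<sigma> i) \<le> g (\<sigma> k)"
  using sortsD[of n \<sigma> g i k] assms by (cases "i = k") (auto simp: lex_less_def)

text \<open>Breaking ties by position makes \<open>lex_less\<close> asymmetric, so the list of
  values of the permutation is the unique sorted arrangement of 1, ..., n.\<close>

lemma sorts_unique:
  assumes "sorts n \<sigma> g" "sorts n \<tau> g"
  shows "\<sigma> = \<tau>"
proof -
  have sorted: "sorted_wrt (lex_less g) (map \<rho> [1..<Suc n])" if "sorts n \<rho> g" for \<rho>
    using sortsD[OF that] by (auto simp: sorted_wrt_iff_nth_less simp del: upt_Suc)
  have mset: "mset (map \<rho> [1..<Suc n]) = mset_set {1..n}" if "sorts n \<rho> g" for \<rho>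
  proof -
    have "\<rho> permutes {1..n}"
      using that by (simp add: sorts_def)
    then have "image_mset \<rho> (mset_set {1..n}) = mset_set {1..n}"
      by (rule permutes_image_mset)
    then show ?thesis
      by (simp add: atLeastLessThanSuc_atLeastAtMost del: upt_Suc)
  qed
  have "map \<sigma> [1..<Suc n] = map \<tau> [1..<Suc n]"
    by (rule sorted_wrt_mset_unique[of "lex_less g"])
      (use sorted mset assms in \<open>auto simp: lex_less_def simp del: upt_Suc\<close>)
  then have "\<sigma> i = \<tau> i" if "i \<in> {1..n}" for i
    using that by (auto simp del: upt_Suc)
  moreover have "\<sigma> i = \<tau> i" if "i \<notin> {1..n}" for i
    using that assms by (auto simp: sorts_def permutes_def)
  ultimately show ?thesis
    by blast
qed

lemma ex_sorts: "\<exists>\<sigma>. sorts n \<sigma> g"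
proof -
  \<comment> \<open>This packs the lexicographic pair into one number. Positions lie between 1 and
    n, so with the factor n + 1 the value of g dominates.\<close>
  define key where "key x = g x * Suc n + x" for x
  define xs where "xs = sort_key key [1..<Suc n]"
  have set_xs: "set xs = {1..n}" and dist: "distinct xs" and len: "length xs = n"
    by (auto simp: xs_def simp del: upt_Suc)
  have key: "lex_less g x y" if "x \<in> {1..n}" "y \<in> {1..n}" "x \<noteq> y" "key x \<le> key y" for x y
  proof -
    have "\<not> g y < g x"
    proof
      assume "g y < g x"
      then have "Suc (g y) * Suc n \<le> g x * Suc n"
        by (intro mult_le_mono1) simp
      then show False
        using that by (simp add: key_def)
    qed
    then show ?thesis
      using that by (cases "g x = g y") (auto simp: lex_less_def key_def)
  qed
  define \<sigma> where "\<sigma> i = (if i \<in> {1..n} then xs ! (i - 1) else i)" for i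
  have "bij_betw \<sigma> {1..n} {1..n}"
  proof (rule bij_betw_imageI)
    show "inj_on \<sigma> {1..n}"
    proof
      fix i k assume "i \<in> {1..n}" "k \<in> {1..n}" "\<sigma> i = \<sigma> k"
      then have "i - 1 = k - 1"
        using dist len nth_eq_iff_index_eq[of xs "i - 1" "k - 1"] by (auto simp: \<sigma>_def)
      then show "i = k"
        using \<open>i \<in> {1..n}\<close> \<open>k \<in> {1..n}\<close> by auto
    qed
    then show "\<sigma> ` {1..n} = {1..n}"
      using set_xs len nth_mem[of _ xs] by (intro endo_inj_surj) (auto simp: \<sigma>_def)
  qed
  then have perm: "\<sigma> permutes {1..n}"
    by (rule bij_imp_permutes) (auto simp: \<sigma>_def)
  have "lex_less g (\<sigma> i) (\<sigma> (Suc i))" if "i \<in> {1..<n}" for i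
  proof (rule key)
    show "\<sigma> i \<in> {1..n}" "\<sigma> (Suc i) \<in> {1..n}"
      using permutes_in_image[OF perm, of i] permutes_in_image[OF perm, of "Suc i"] that by simp_all
    show "\<sigma> i \<noteq> \<sigma> (Suc i)"
      using injD[OF permutes_inj[OF perm], of i "Suc i"] by auto
    have "sorted (map key xs)"
      by (simp add: xs_def)
    then have "map key xs ! (i - 1) \<le> map key xs ! i"
      using that len by (intro sorted_nth_mono) auto
    then show "key (\<sigma> i) \<le> key (\<sigma> (Suc i))"
      using that len nth_map[of "i - 1" xs key] by (auto simp: \<sigma>_def)
  qed
  with perm show ?thesis
    by (auto simp: sorts_def)
qed

section \<open>Sequences encoded by colored permutations\<close>

definition sequences_with_last_max :: "nat \<Rightarrow> nat \<Rightarrow> nat \<Rightarrow> (nat \<Rightarrow> nat) set" where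
  "sequences_with_last_max n N L = {g \<in> {1..n} \<rightarrow>\<^sub>E {0..N}.
     g L = N \<and> (\<forall>i\<in>{L<..n}. g i < N) \<and> (\<exists>i\<in>{1..n}. g i = 0)}"

text \<open>Sorting with ties broken by position moves the last occurrence of the maximum to the end
  and a minimal value to the front. The conditions on g thus become conditions on the two ends of
  its sorting permutation.\<close>

lemma sequences_with_last_max_iff:
  assumes "sorts n \<sigma> g" "L \<in> {1..n}"
  shows "g \<in> sequences_with_last_max n N L \<longleftrightarrow>
    g \<in> extensional {1..n} \<and> \<sigma> n = L \<and> g (\<sigma> n) = N \<and> g (\<sigma> 1) = 0"
proof
  have perm: "\<sigma> permutes {1..n}"
    using assms(1) by (simp add: sorts_def)
  have n: "n \<in> {1..n}"
    using assms(2) by simp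
  have surj: "\<exists>k\<in>{1..n}. i = \<sigma> k" if "i \<in> {1..n}" for i
    using permutes_image[OF perm] that by blast
  {
    assume g: "g \<in> sequences_with_last_max n N L"
    obtain k where k: "k \<in> {1..n}" "L = \<sigma> k"
      using surj assms(2) by blast
    have "k = n"
    proof (rule ccontr)
      assume "k \<noteq> n"
      then have "lex_less g L (\<sigma> n)"
        using sortsD[OF assms(1), of k n] k by simp
      moreover have "\<sigma> n \<in> {1..n}"
        using permutes_in_image[OF perm] n by blast
      ultimately show False
        using g by (auto simp: sequences_with_last_max_def lex_less_def PiE_def Pi_def)
    qed
    obtain x where "x \<in> {1..n}" "g x = 0"
      using g unfolding sequences_with_last_max_def by blast
    with surj obtain i where "i \<in> {1..n}" "g (\<sigma> i) = 0"
      by blast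
    then have "g (\<sigma> 1) = 0"
      using sorts_mono[OF assms(1), of 1 i] by simp
    with g k \<open>k = n\<close> show "g \<in> extensional {1..n} \<and> \<sigma> n = L \<and> g (\<sigma> n) = N \<and> g (\<sigma> 1) = 0"
      by (auto simp: sequences_with_last_max_def PiE_def)
  }
  {
    assume g: "g \<in> extensional {1..n} \<and> \<sigma> n = L \<and> g (\<sigma> n) = N \<and> g (\<sigma> 1) = 0"
    have "g i \<le> N" if i: "i \<in> {1..n}" for i
      using surj[OF i] sorts_mono[OF assms(1), of _ n] g by auto
    moreover have "g i < N" if i: "i \<in> {L<..n}" for i
    proof -
      obtain k where k: "k \<in> {1..n}" "i = \<sigma> k"
        using surj[of i] i by auto
      with i g have "k \<noteq> n"
        by auto
      then have "lex_less g i (\<sigma> n)"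
        using sortsD[OF assms(1), of k n] k by simp
      then show ?thesis
        using g i by (auto simp: lex_less_def)
    qed
    moreover have "\<exists>i\<in>{1..n}. g i = 0"
      using g n permutes_in_image[OF perm, of 1] by (intro bexI[of _ "\<sigma> 1"]) auto
    ultimately show "g \<in> sequences_with_last_max n N L"
      using g by (auto simp: sequences_with_last_max_def PiE_def)
  }
qed

definition descents :: "nat \<Rightarrow> (nat \<Rightarrow> nat) \<Rightarrow> (nat \<Rightarrow> nat) \<Rightarrow> nat set" where
  "descents n \<sigma> \<epsilon> =
     {i \<in> {1..<n}. \<epsilon> i > \<epsilon> (Suc i) \<or> \<epsilon> i = \<epsilon> (Suc i) \<and> \<sigma> i > \<sigma> (Suc i)}"

text \<open>\<open>des\<close> also inspects index n, against the appended letter n + 1 of color 0.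
  A last letter of color 0 that is at most n yields no descent there.\<close>

lemma des_eq_card_descents:
  assumes "\<sigma> permutes {1..n}" "\<epsilon> n = 0" "n \<ge> 1"
  shows "des n \<sigma> \<epsilon> = card (descents n \<sigma> \<epsilon>)"
proof -
  have "\<sigma> n \<le> n"
    using permutes_in_image[OF assms(1), of n] assms(3) by auto
  then have "{i \<in> {1..n}. (\<epsilon>(n + 1 := 0)) i > (\<epsilon>(n + 1 := 0)) (i + 1) \<or>
      (\<epsilon>(n + 1 := 0)) i = (\<epsilon>(n + 1 := 0)) (i + 1) \<and>
      (\<sigma>(n + 1 := n + 1)) i > (\<sigma>(n + 1 := n + 1)) (i + 1)} = descents n \<sigma> \<epsilon>"
    using assms(2) by (auto simp: descents_def)
  then show ?thesis
    by (simp only: des_def Let_def)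
qed

text \<open>As e and e' are less than r, comparing r * q + e with r * q' + e' means comparing
  quotients first and remainders second. With equal quotients and ties broken by s, the right side
  fails exactly at a descent.\<close>

lemma height_step_iff:
  fixes q q' e e' s s' r :: nat
  assumes "e < r" "e' < r" "s \<noteq> s'"
  shows "q + of_bool (e > e' \<or> e = e' \<and> s > s') \<le> q' \<longleftrightarrow>
    r * q + e < r * q' + e' \<or> r * q + e = r * q' + e' \<and> s < s'"
proof (cases q q' rule: linorder_cases)
  case less
  then have "r * Suc q \<le> r * q'"
    by (intro mult_le_mono2) simp
  with less assms show ?thesis
    by auto
next
  case equal
  with assms show ?thesis
    by auto
next
  case greater
  then have "r * Suc q' \<le> r * q"
    by (intro mult_le_mono2) simp
  with greater assms show ?thesis
    by auto
qed

definition admissible :: "nat \<Rightarrow> nat \<Rightarrow> nat \<Rightarrow> ((nat \<Rightarrow> nat) \<times> (nat \<Rightarrow> nat)) set" where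
  "admissible r n L = {(\<sigma>, \<epsilon>) \<in> colored_perms r n. \<epsilon> 1 = 0 \<and> \<epsilon> n = 0 \<and> \<sigma> n = L}"

lemma finite_admissible: "finite (admissible r n L)"
proof (rule finite_subset)
  show "admissible r n L \<subseteq> {\<sigma>. \<sigma> permutes {1..n}} \<times> ({1..n} \<rightarrow>\<^sub>E {0..<r})"
    by (auto simp: admissible_def colored_perms_def)
qed (intro finite_cartesian_product finite_permutations finite_PiE; simp)

text \<open>
  Sort \<open>g\<close> with ties broken by position; the remainders modulo \<open>r\<close> of the sorted values are the
  colors, and the quotients increase weakly, strictly at the descents.
\<close>

lemma bij_betw_sequences_with_last_max:
  assumes "L \<in> {1..n}" "r \<ge> 1"
  shows "bij_betw (\<lambda>((\<sigma>, \<epsilon>), q). \<lambda>i\<in>{1..n}. r * q (inv \<sigma> i) + \<epsilon> (inv \<sigma> i))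
    (SIGMA (\<sigma>, \<epsilon>):admissible r n L. heights n (descents n \<sigma> \<epsilon>) j)
    (sequences_with_last_max n (r * j) L)"
    (is "bij_betw ?f ?S ?G")
proof -
  have n: "1 \<le> n"
    using assms(1) by simp
  have f: "?f ((\<sigma>, \<epsilon>), q) (\<sigma> i) = r * q i + \<epsilon> i" if "\<sigma> permutes {1..n}" "i \<in> {1..n}" for \<sigma> \<epsilon> q i
    using that permutes_in_image[OF that(1), of i] permutes_inverses[OF that(1)] by simp
  \<comment> \<open>The core equivalence: the assembled sequence is sorted by its permutation
    exactly when the heights rise at the descents.\<close>
  have sorts: "sorts n \<sigma> (?f ((\<sigma>, \<epsilon>), q)) \<longleftrightarrow>
      (\<forall>i\<in>{1..<n}. q i + of_bool (i \<in> descents n \<sigma> \<epsilon>) \<le> q (Suc i))"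
    if perm: "\<sigma> permutes {1..n}" and \<epsilon>: "\<epsilon> \<in> {1..n} \<rightarrow>\<^sub>E {0..<r}" for \<sigma> \<epsilon> q
  proof -
    have "lex_less (?f ((\<sigma>, \<epsilon>), q)) (\<sigma> i) (\<sigma> (Suc i)) \<longleftrightarrow>
        q i + of_bool (i \<in> descents n \<sigma> \<epsilon>) \<le> q (Suc i)" if i: "i \<in> {1..<n}" for i
    proof -
      have "\<sigma> i \<noteq> \<sigma> (Suc i)"
        using injD[OF permutes_inj[OF perm], of i "Suc i"] by auto
      moreover have "\<epsilon> i < r" "\<epsilon> (Suc i) < r"
        using \<epsilon> i by (auto simp: PiE_def Pi_def)
      moreover have "i \<in> {1..n}" "Suc i \<in> {1..n}"
        using i by auto
      moreover have "i \<in> descents n \<sigma> \<epsilon> \<longleftrightarrow> \<epsilon> i > \<epsilon> (Suc i) \<or> \<epsilon> i = \<epsilon> (Suc i) \<and> \<sigma> i > \<sigma> (Suc i)"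
        using i by (simp add: descents_def)
      ultimately show ?thesis
        using height_step_iff[of "\<epsilon> i" r "\<epsilon> (Suc i)" "\<sigma> i" "\<sigma> (Suc i)" "q i" "q (Suc i)"]
        unfolding lex_less_def by (simp only: f[OF perm] simp_thms)
    qed
    with perm show ?thesis
      unfolding sorts_def by blast
  qed
  have Sigma: "((\<sigma>, \<epsilon>), q) \<in> ?S \<longleftrightarrow> \<sigma> permutes {1..n} \<and> \<epsilon> \<in> {1..n} \<rightarrow>\<^sub>E {0..<r} \<and>
      q \<in> extensional {1..n} \<and> sorts n \<sigma> (?f ((\<sigma>, \<epsilon>), q)) \<and>
      \<epsilon> 1 = 0 \<and> \<epsilon> n = 0 \<and> \<sigma> n = L \<and> q 1 = 0 \<and> q n = j" for \<sigma> \<epsilon> q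
  proof (cases "\<sigma> permutes {1..n} \<and> \<epsilon> \<in> {1..n} \<rightarrow>\<^sub>E {0..<r}")
    case True
    then show ?thesis
      using sorts[of \<sigma> \<epsilon> q] by (auto simp: admissible_def colored_perms_def heights_def PiE_def)
  qed (auto simp: admissible_def colored_perms_def)
  show ?thesis
  proof (rule bij_betw_imageI)
    show "inj_on ?f ?S"
    proof (rule inj_onI)
      fix x y assume x: "x \<in> ?S" and y: "y \<in> ?S" and eq: "?f x = ?f y"
      obtain \<sigma> \<epsilon> q \<sigma>' \<epsilon>' q' where xy: "x = ((\<sigma>, \<epsilon>), q)" "y = ((\<sigma>', \<epsilon>'), q')"
        by (metis surj_pair)
      note X = x[unfolded xy Sigma] and Y = y[unfolded xy Sigma]
      have perm: "\<sigma> permutes {1..n}" "\<sigma>' permutes {1..n}"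
        using X Y by auto
      \<comment> \<open>Both permutations sort the same sequence, so they agree. Division by r then
        separates heights from colors.\<close>
      have "sorts n \<sigma> (?f x)" "sorts n \<sigma>' (?f x)"
        using X Y unfolding eq by (simp_all only: xy eq[unfolded xy])
      then have \<sigma>: "\<sigma> = \<sigma>'"
        by (rule sorts_unique)
      have "q i = q' i \<and> \<epsilon> i = \<epsilon>' i" if i: "i \<in> {1..n}" for i
      proof -
        have v: "r * q i + \<epsilon> i = r * q' i + \<epsilon>' i"
          using fun_cong[OF eq, of "\<sigma> i"] f[OF perm(1) i, of \<epsilon> q] f[OF perm(2) i, of \<epsilon>' q']
          unfolding xy \<sigma> by (simp only:)
        have "\<epsilon> i < r" "\<epsilon>' i < r"
          using X Y i by (auto simp: PiE_def Pi_def)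
        then show ?thesis
          using arg_cong[OF v, of "\<lambda>a. a div r"] arg_cong[OF v, of "\<lambda>a. a mod r"] by simp
      qed
      moreover have "q \<in> extensional {1..n}" "q' \<in> extensional {1..n}"
        "\<epsilon> \<in> extensional {1..n}" "\<epsilon>' \<in> extensional {1..n}"
        using X Y by (simp_all add: PiE_def)
      ultimately have "q = q'" "\<epsilon> = \<epsilon>'"
        using extensionalityI[of q "{1..n}" q'] extensionalityI[of \<epsilon> "{1..n}" \<epsilon>'] by blast+
      with \<sigma> show "x = y"
        by (simp add: xy)
    qed
    show "?f ` ?S = ?G"
    proof (intro equalityI subsetI)
      fix g assume "g \<in> ?f ` ?S"
      then obtain x where x: "x \<in> ?S" "g = ?f x"
        by blast
      obtain \<sigma> \<epsilon> q where x': "x = ((\<sigma>, \<epsilon>), q)"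
        by (metis surj_pair)
      note X = x(1)[unfolded x' Sigma]
      have g: "g = ?f ((\<sigma>, \<epsilon>), q)"
        using x x' by simp
      have "sorts n \<sigma> g" "\<sigma> permutes {1..n}"
        using X unfolding g by blast+
      moreover have "g \<in> extensional {1..n}"
        unfolding g by simp
      moreover have "g (\<sigma> n) = r * j" "g (\<sigma> 1) = 0"
        using X n f[OF \<open>\<sigma> permutes {1..n}\<close>, of n \<epsilon> q] f[OF \<open>\<sigma> permutes {1..n}\<close>, of 1 \<epsilon> q]
        unfolding g by auto
      ultimately show "g \<in> ?G"
        using X sequences_with_last_max_iff[of n \<sigma> g L] assms(1) by blast
    next
      fix g assume g: "g \<in> ?G"
      obtain \<sigma> where \<sigma>: "sorts n \<sigma> g"
        using ex_sorts by blast
      then have perm: "\<sigma> permutes {1..n}"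
        by (simp add: sorts_def)
      have G: "g \<in> extensional {1..n}" "\<sigma> n = L" "g (\<sigma> n) = r * j" "g (\<sigma> 1) = 0"
        using g sequences_with_last_max_iff[OF \<sigma> assms(1)] by blast+
      define \<epsilon> where "\<epsilon> = (\<lambda>i\<in>{1..n}. g (\<sigma> i) mod r)"
      define q where "q = (\<lambda>i\<in>{1..n}. g (\<sigma> i) div r)"
      have inv: "inv \<sigma> i \<in> {1..n} \<longleftrightarrow> i \<in> {1..n}" "\<sigma> (inv \<sigma> i) = i" for i
        using permutes_in_image[OF permutes_inv[OF perm]] permutes_inverses(1)[OF perm] by auto
      have fg: "g = ?f ((\<sigma>, \<epsilon>), q)"
      proof (rule extensionalityI[OF G(1)])
        fix i assume "i \<in> {1..n}"
        then show "g i = ?f ((\<sigma>, \<epsilon>), q) i"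
          using inv[of i] by (simp add: \<epsilon>_def q_def)
      qed simp
      have "((\<sigma>, \<epsilon>), q) \<in> ?S"
        unfolding Sigma fg[symmetric] using perm \<sigma> G n assms(2) by (auto simp: \<epsilon>_def q_def)
      with fg show "g \<in> ?f ` ?S"
        by (rule image_eqI)
    qed
  qed
qed

section \<open>Counting sequences and combining the generating functions\<close>

lemma prod_split_at:
  fixes a b :: "'b::comm_monoid_mult"
  assumes "L \<in> {1..n}"
  shows "(\<Prod>i\<in>{1..n}. if i < L then a else if i = L then 1 else b) = a ^ (L - 1) * b ^ (n - L)"
proof -
  have "(\<Prod>i\<in>{1..n}. if i < L then a else if i = L then 1 else b)
      = (\<Prod>i\<in>{1..<L} \<union> {L<..n}. if i < L then a else if i = L then 1 else b)"
    using assms by (intro prod.mono_neutral_right) auto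
  also have "\<dots> = (\<Prod>i\<in>{1..<L}. a) * (\<Prod>i\<in>{L<..n}. b)"
    by (subst prod.union_disjoint) (auto intro!: arg_cong2[of _ _ _ _ "(*)"] prod.cong)
  finally show ?thesis
    by simp
qed

text \<open>Without the demand for a zero the sequences form a product T, with N + 1 choices before
  L, one at L and N after it. The sequences in T avoiding 0 form a product U, which is removed. For
  N = 0 the value at L is itself zero, so nothing is removed.\<close>

lemma card_sequences_with_last_max:
  assumes "L \<in> {1..n}"
  shows "card (sequences_with_last_max n N L) + (if N = 0 then 0 else (N - 1) ^ (n - L) * N ^ (L - 1))
    = N ^ (n - L) * (N + 1) ^ (L - 1)"
proof -
  define T where "T = (\<Pi>\<^sub>E i\<in>{1..n}. if i < L then {0..N} else if i = L then {N} else {0..<N})"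
  define U where "U = (\<Pi>\<^sub>E i\<in>{1..n}. if i < L then {1..N} else if i = L then {N} else {1..<N})"
  have "card T = (\<Prod>i\<in>{1..n}. if i < L then N + 1 else if i = L then 1 else N)"
    unfolding T_def by (subst card_PiE) (auto intro!: prod.cong)
  then have card_T: "card T = N ^ (n - L) * (N + 1) ^ (L - 1)"
    by (simp only: prod_split_at[OF assms] mult.commute)
  have "card U = (\<Prod>i\<in>{1..n}. if i < L then N else if i = L then 1 else N - 1)"
    unfolding U_def by (subst card_PiE) (auto intro!: prod.cong)
  then have card_U: "card U = (N - 1) ^ (n - L) * N ^ (L - 1)"
    by (simp only: prod_split_at[OF assms] mult.commute)
  have T: "g \<in> T \<longleftrightarrow> g \<in> {1..n} \<rightarrow>\<^sub>E {0..N} \<and> g L = N \<and> (\<forall>i\<in>{L<..n}. g i < N)" for g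
  proof
    assume g: "g \<in> T"
    have "g i \<le> N" if "i \<in> {1..n}" for i
      using PiE_mem[OF g[unfolded T_def] that] by (auto split: if_splits)
    moreover have "g i < N" if "i \<in> {L<..n}" for i
      using PiE_mem[OF g[unfolded T_def], of i] that by (auto split: if_splits)
    moreover have "g L = N"
      using PiE_mem[OF g[unfolded T_def] assms] by simp
    moreover have "g \<in> extensional {1..n}"
      using g by (simp add: T_def PiE_def)
    ultimately show "g \<in> {1..n} \<rightarrow>\<^sub>E {0..N} \<and> g L = N \<and> (\<forall>i\<in>{L<..n}. g i < N)"
      by (auto simp: PiE_def)
  next
    assume g: "g \<in> {1..n} \<rightarrow>\<^sub>E {0..N} \<and> g L = N \<and> (\<forall>i\<in>{L<..n}. g i < N)"
    then show "g \<in> T"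
      unfolding T_def by (auto simp: PiE_def Pi_def)
  qed
  have U: "g \<in> U \<longleftrightarrow> g \<in> T \<and> (\<forall>i\<in>{1..n}. g i \<noteq> 0)" if "N \<noteq> 0" for g
  proof
    assume g: "g \<in> U"
    have "g i \<noteq> 0" if "i \<in> {1..n}" for i
      using PiE_mem[OF g[unfolded U_def] that] \<open>N \<noteq> 0\<close> by (auto split: if_splits)
    moreover have "g \<in> T"
      using g unfolding U_def T_def by (rule subsetD[OF PiE_mono, rotated]) auto
    ultimately show "g \<in> T \<and> (\<forall>i\<in>{1..n}. g i \<noteq> 0)"
      by blast
  next
    assume g: "g \<in> T \<and> (\<forall>i\<in>{1..n}. g i \<noteq> 0)"
    show "g \<in> U"
      unfolding U_def
    proof (rule PiE_I)
      fix i assume i: "i \<in> {1..n}"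
      have "g i \<in> (if i < L then {0..N} else if i = L then {N} else {0..<N})" "g i \<noteq> 0"
        using PiE_mem[OF conjunct1[OF g, unfolded T_def] i] g i by blast+
      then show "g i \<in> (if i < L then {1..N} else if i = L then {N} else {1..<N})"
        by (auto split: if_splits)
    next
      fix i assume "i \<notin> {1..n}"
      then show "g i = undefined"
        using g unfolding T_def by (auto dest: PiE_arb)
    qed
  qed
  have S: "g \<in> sequences_with_last_max n N L \<longleftrightarrow> g \<in> T \<and> (\<exists>i\<in>{1..n}. g i = 0)" for g
    unfolding sequences_with_last_max_def T by simp
  show ?thesis
  proof (cases "N = 0")
    case True
    have "\<exists>i\<in>{1..n}. g i = 0" if "g \<in> T" for g
      using that assms True by (intro bexI[of _ L]) (simp_all add: T)
    then have "sequences_with_last_max n N L = T"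
      by (intro set_eqI) (simp only: S, blast)
    with True card_T show ?thesis
      by simp
  next
    case False
    have "finite T"
      unfolding T_def by (intro finite_PiE) auto
    have "U \<subseteq> T"
      using U[OF False] by blast
    moreover have "sequences_with_last_max n N L = T - U"
    proof (rule set_eqI)
      show "g \<in> sequences_with_last_max n N L \<longleftrightarrow> g \<in> T - U" for g
        unfolding S Diff_iff U[OF False] by auto
    qed
    ultimately have "card (sequences_with_last_max n N L) + card U = card T"
      using \<open>finite T\<close> by (simp add: card_Diff_subset finite_subset card_mono)
    with False card_T card_U show ?thesis
      by simp
  qed
qed

text \<open>The bijection fibers the sequences over admissible colored permutations. In each fiber
  the d steps of the heights cancel the factor (1 - t) ^ d and leave t to the number of
  descents.\<close>

lemma A0_generating_function:
  assumes "k \<le> d" "r \<ge> 1"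
  shows "(1 - fps_X) ^ d *
      Abs_fps (\<lambda>j. of_nat (card (sequences_with_last_max (d + 1) (r * j) (d + 1 - k))) :: rat)
    = Abs_fps (\<lambda>m. of_nat (A0 r (d + 1) (k + 1) m))"
proof -
  \<comment> \<open>\<open>A0\<close> with parameters d + 1 and k + 1 prescribes the last letter (d
    + 1) + 1 - (k + 1) = d + 1 - k.\<close>
  let ?L = "d + 1 - k" and ?n = "d + 1"
  let ?B = "admissible r ?n ?L"
  have L: "?L \<in> {1..?n}"
    using assms by auto
  have des: "des ?n \<sigma> \<epsilon> = card (descents ?n \<sigma> \<epsilon> \<inter> {1..<?n})" if "(\<sigma>, \<epsilon>) \<in> ?B" for \<sigma> \<epsilon>
  proof -
    have "descents ?n \<sigma> \<epsilon> \<inter> {1..<?n} = descents ?n \<sigma> \<epsilon>"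
      by (auto simp: descents_def)
    moreover have "\<sigma> permutes {1..?n}" "\<epsilon> ?n = 0"
      using that by (auto simp: admissible_def colored_perms_def)
    ultimately show ?thesis
      by (subst des_eq_card_descents) simp_all
  qed
  have card: "card (sequences_with_last_max ?n (r * j) ?L)
      = (\<Sum>(\<sigma>, \<epsilon>)\<in>?B. card (heights ?n (descents ?n \<sigma> \<epsilon>) j))" for j
    using bij_betw_same_card[OF bij_betw_sequences_with_last_max[OF L assms(2), of j]]
      finite_admissible[of r ?n ?L]
    by (subst (asm) card_SigmaI) (auto simp: finite_heights case_prod_unfold)
  have "Abs_fps (\<lambda>j. of_nat (card (sequences_with_last_max ?n (r * j) ?L)) :: rat)
      = (\<Sum>(\<sigma>, \<epsilon>)\<in>?B. Abs_fps (\<lambda>j. of_nat (card (heights ?n (descents ?n \<sigma> \<epsilon>) j))))"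
    unfolding card by (simp add: fps_eq_iff fps_sum_nth case_prod_unfold)
  then have "(1 - fps_X) ^ d * Abs_fps (\<lambda>j. of_nat (card (sequences_with_last_max ?n (r * j) ?L)) :: rat)
      = (\<Sum>(\<sigma>, \<epsilon>)\<in>?B. (1 - fps_X) ^ d * Abs_fps (\<lambda>j. of_nat (card (heights ?n (descents ?n \<sigma> \<epsilon>) j))))"
    by (simp add: sum_distrib_left case_prod_unfold)
  also have "\<dots> = (\<Sum>(\<sigma>, \<epsilon>)\<in>?B. fps_X ^ des ?n \<sigma> \<epsilon>)"
  proof (intro sum.cong refl, clarify)
    fix \<sigma> \<epsilon> assume "(\<sigma>, \<epsilon>) \<in> ?B"
    then show "(1 - fps_X) ^ d * Abs_fps (\<lambda>j. of_nat (card (heights ?n (descents ?n \<sigma> \<epsilon>) j)) :: rat)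
        = fps_X ^ des ?n \<sigma> \<epsilon>"
      using heights_generating_function[of ?n "descents ?n \<sigma> \<epsilon>"] des by simp
  qed
  also have "\<dots> = Abs_fps (\<lambda>m. of_nat (A0 r ?n (k + 1) m))"
  proof (rule fps_ext)
    fix m
    have "fps_nth (\<Sum>(\<sigma>, \<epsilon>)\<in>?B. fps_X ^ des ?n \<sigma> \<epsilon> :: rat fps) m
        = (\<Sum>x\<in>?B. if des ?n (fst x) (snd x) = m then 1 else 0)"
      unfolding fps_sum_nth case_prod_unfold by (intro sum.cong) auto
    also have "\<dots> = of_nat (card {x \<in> ?B. des ?n (fst x) (snd x) = m})"
      using finite_admissible[of r ?n ?L] by (simp add: sum.If_cases Int_def)
    also have "{x \<in> ?B. des ?n (fst x) (snd x) = m} = {(\<sigma>, \<epsilon>) \<in> colored_perms r ?n.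
        \<epsilon> 1 = 0 \<and> \<epsilon> ?n = 0 \<and> \<sigma> ?n = ?n + 1 - (k + 1) \<and> des ?n \<sigma> \<epsilon> = m}"
      by (auto simp: admissible_def)
    finally show "fps_nth (\<Sum>(\<sigma>, \<epsilon>)\<in>?B. fps_X ^ des ?n \<sigma> \<epsilon> :: rat fps) m
        = fps_nth (Abs_fps (\<lambda>m. of_nat (A0 r ?n (k + 1) m))) m"
      unfolding A0_def by simp
  qed
  finally show ?thesis .
qed

text \<open>Subtract the h-vector expansions of the weak chain counts for N and N - 1. The
  coefficient of each h_k is the number of sequences just computed with n = d + 1 and L = d + 1 -
  k.\<close>

lemma card_multichains_eq_h_vector:
  assumes "abstract_simplicial_complex \<Delta>" "finite \<Delta>" "complex_dim \<Delta> = int d - 1"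
  shows "of_nat (card (multichains N \<Delta>))
    = (\<Sum>k=0..d. h_vector \<Delta> k * of_nat (card (sequences_with_last_max (d + 1) N (d + 1 - k))))"
proof -
  have Y: "of_nat (\<Sum>F\<in>\<Delta>. x ^ card F)
      = (\<Sum>k=0..d. h_vector \<Delta> k * (of_nat x ^ k * (of_nat x + 1) ^ (d - k)))" for x :: nat
    using sum_power_card_eq_h_vector[OF assms(2,3), of "of_nat x"] by simp
  have seq: "card (sequences_with_last_max (d + 1) N (d + 1 - k))
      + (if N = 0 then 0 else (N - 1) ^ k * N ^ (d - k)) = N ^ k * (N + 1) ^ (d - k)" if "k \<le> d" for k
    using card_sequences_with_last_max[of "d + 1 - k" "d + 1" N] that by (auto simp: Suc_diff_le)
  show ?thesis
  proof (cases N)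
    case 0
    \<comment> \<open>For N = 0 there is no previous count to subtract: the empty list is the only
      chain, and the expansion at 0 equals 1.\<close>
    have "(\<Sum>F\<in>\<Delta>. 0 ^ card F) = card (weak_chains 0 \<Delta>)"
      using card_weak_chains[OF assms(2,1), of 0] by simp
    also have "weak_chains 0 \<Delta> = {[]}"
      by (auto simp: weak_chains_def)
    finally have "(\<Sum>k=0..d. h_vector \<Delta> k * (of_nat 0 ^ k * (of_nat 0 + 1) ^ (d - k))) = 1"
      by (subst Y[symmetric]) simp
    moreover have "card (sequences_with_last_max (d + 1) 0 (d + 1 - k)) = 0 ^ k" if "k \<le> d" for k
      using seq[OF that] 0 by simp
    ultimately show ?thesis
      using 0 by (simp add: multichains_0)
  next
    case (Suc M)
    have "of_nat (card (multichains N \<Delta>)) + of_nat (\<Sum>F\<in>\<Delta>. M ^ card F) = (of_nat (\<Sum>F\<in>\<Delta>. N ^ card F) :: rat)"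
      using card_multichains_Suc[OF assms(2,1), of M] unfolding Suc of_nat_add[symmetric] by simp
    then have "of_nat (card (multichains N \<Delta>)) = (\<Sum>k=0..d. h_vector \<Delta> k *
        (of_nat N ^ k * (of_nat N + 1) ^ (d - k) - of_nat M ^ k * (of_nat M + 1) ^ (d - k)))"
      unfolding Y right_diff_distrib sum_subtractf by simp
    also have "\<dots> = (\<Sum>k=0..d. h_vector \<Delta> k * of_nat (card (sequences_with_last_max (d + 1) N (d + 1 - k))))"
    proof (intro sum.cong refl arg_cong2[of _ _ _ _ "(*)"])
      fix k assume "k \<in> {0..d}"
      then have "card (sequences_with_last_max (d + 1) N (d + 1 - k)) + M ^ k * (M + 1) ^ (d - k)
          = N ^ k * (N + 1) ^ (d - k)"
        using seq[of k] Suc by simp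
      from arg_cong[OF this, of "of_nat :: nat \<Rightarrow> rat"]
      show "of_nat N ^ k * (of_nat N + 1) ^ (d - k) - of_nat M ^ k * (of_nat M + 1) ^ (d - k)
          = (of_nat (card (sequences_with_last_max (d + 1) N (d + 1 - k))) :: rat)"
        by (simp add: algebra_simps)
    qed
    finally show ?thesis .
  qed
qed

text \<open>Multisets of size j supported on a clique correspond to interlaced lists, and these to
  multichains of length r * j. The equality of dimensions supplies the exponent d.\<close>

lemma h_series_multichain_complex:
  assumes "abstract_simplicial_complex \<Delta>" "finite \<Delta>" "complex_dim \<Delta> = int d - 1" "r \<ge> 1"
  shows "h_series (multichain_complex r \<Delta>)
    = (1 - fps_X) ^ d * Abs_fps (\<lambda>j. of_nat (card (multichains (r * j) \<Delta>)))"
proof -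
  have fin: "\<And>F. F \<in> \<Delta> \<Longrightarrow> finite F"
    using assms(1) by (simp add: abstract_simplicial_complex_def)
  have "card {M. set_mset M \<in> multichain_complex r \<Delta> \<and> size M = j} = card (multichains (r * j) \<Delta>)" for j
    using bij_betw_same_card[OF bij_betw_interlaced_lists[OF assms(2) fin, of r j]]
      bij_betw_same_card[OF bij_betw_reshape[of j r \<Delta>]] by simp
  moreover have "finite K" if "K \<in> multichain_complex r \<Delta>" for K
    using that by (simp add: multichain_complex_def clique_complex_def)
  ultimately show ?thesis
    using h_series_eq_sum_faces[of "multichain_complex r \<Delta>" d]
      multiset_generating_function[of "multichain_complex r \<Delta>"]
      finite_multichain_complex[OF assms(2), of r]
      complex_dim_multichain_complex[OF assms(2,1,4)] assms(3)
    by simp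
qed

theorem theorem4p5:
  fixes \<Delta> :: "'a set set" and d r m :: nat
  assumes "abstract_simplicial_complex \<Delta>"
    and "finite \<Delta>"
    and "complex_dim \<Delta> = int d - 1"
    and "r \<ge> 1"
    and "m \<le> d"
  shows "h_vector (multichain_complex r \<Delta>) m
         = (\<Sum>k=0..d. of_nat (A0 r (d + 1) (k + 1) m) * h_vector \<Delta> k)"
proof -
  let ?G = "\<lambda>k. Abs_fps (\<lambda>j. of_nat (card (sequences_with_last_max (d + 1) (r * j) (d + 1 - k))) :: rat)"
  have "Abs_fps (\<lambda>j. of_nat (card (multichains (r * j) \<Delta>))) = (\<Sum>k=0..d. fps_const (h_vector \<Delta> k) * ?G k)"
    unfolding card_multichains_eq_h_vector[OF assms(1-3)] by (simp add: fps_eq_iff fps_sum_nth)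
  then have "h_series (multichain_complex r \<Delta>)
      = (\<Sum>k=0..d. fps_const (h_vector \<Delta> k) * ((1 - fps_X) ^ d * ?G k))"
    by (simp only: h_series_multichain_complex[OF assms(1-4)] sum_distrib_left mult.left_commute)
  also have "\<dots> = (\<Sum>k=0..d. fps_const (h_vector \<Delta> k) * Abs_fps (\<lambda>m. of_nat (A0 r (d + 1) (k + 1) m)))"
    by (intro sum.cong refl, subst A0_generating_function) (use assms(4) in auto)
  finally show ?thesis
    by (simp add: h_vector_def fps_sum_nth mult.commute)
qed

end
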